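(* Let $G$ be a connected $d$-regular simple graph with $d\ge 3$ which is not $K_4$, $K_5$, or $K_{3,3}$. Then \[ 1-\frac{2}{d}<\frac{\mathscr{K}_{nb}(G)}{\mathscr{K}_e(G)}<1. \]
   Context: Kemeny's constant of an irreducible finite Markov chain with transition matrix $P$ whose eigenvalues (with multiplicity) are $1=\rho_1,\rho_2,\dots,\rho_N$ (with $1$ simple) is $\mathscr{K}(P)=\sum_{i=2}^{N}\frac{1}{1-\rho_i}$. Arcs of $G$: for each edge $\{u,v\}$ the two ordered pairs $(u,v),(v,u)$. $\mathscr{K}_e(G)$ is Kemeny's constant of the chain on arcs where from $(u,v)$ one moves to $(v,w)$ with probability $1/\deg(v)$ for each neighbor $w$ of $v$. $\mathscr{K}_{nb}(G)$ is Kemeny's constant of the non-backtracking chain on arcs where from $(u,v)$ one moves to $(v,w)$ with probability $1/(\deg(v)-1)$ for each neighbor $w\neq u$ of $v$. *)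

theory Defs
  imports "Jordan_Normal_Form.Char_Poly" "HOL-Computational_Algebra.Polynomial"
begin

section \<open>Kemeny's constant\<close>

text \<open>Eigenvalues with multiplicity of a square complex matrix are the roots (proots) (with
  multiplicity) of its characteristic polynomial. One copy of the eigenvalue 1 is removed
  and the remaining terms 1/(1 - rho) are summed.  For a real matrix the non-real
  eigenvalues come in conjugate pairs, so this sum is real; we take its real part.\<close>

definition kemeny :: "complex mat \<Rightarrow> real" where
  "kemeny P = Re (\<Sum>\<rho>\<in>#(proots (char_poly P) - {#1#}). 1 / (1 - \<rho>))"

section \<open>Simple graphs\<close>

text \<open>A simple graph is given by a finite vertex set V and a symmetric irreflexive
  adjacency relation E supported on V.\<close>

definition simple_graph :: "'a set \<Rightarrow> ('a \<Rightarrow> 'a \<Rightarrow> bool) \<Rightarrow> bool" where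
  "simple_graph V E \<longleftrightarrow> finite V \<and> (\<forall>u v. E u v \<longrightarrow> u \<in> V \<and> v \<in> V)
     \<and> (\<forall>u v. E u v \<longrightarrow> E v u) \<and> (\<forall>u. \<not> E u u)"

definition degree :: "'a set \<Rightarrow> ('a \<Rightarrow> 'a \<Rightarrow> bool) \<Rightarrow> 'a \<Rightarrow> nat" where
  "degree V E v = card {w \<in> V. E v w}"

definition regular :: "'a set \<Rightarrow> ('a \<Rightarrow> 'a \<Rightarrow> bool) \<Rightarrow> nat \<Rightarrow> bool" where
  "regular V E d \<longleftrightarrow> (\<forall>v\<in>V. degree V E v = d)"

definition connected_graph :: "'a set \<Rightarrow> ('a \<Rightarrow> 'a \<Rightarrow> bool) \<Rightarrow> bool" where
  "connected_graph V E \<longleftrightarrow> V \<noteq> {} \<and>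
     (\<forall>u\<in>V. \<forall>v\<in>V. (u, v) \<in> {(x, y). E x y}\<^sup>*)"

definition graph_iso :: "'a set \<Rightarrow> ('a \<Rightarrow> 'a \<Rightarrow> bool) \<Rightarrow> 'b set \<Rightarrow> ('b \<Rightarrow> 'b \<Rightarrow> bool) \<Rightarrow> bool" where
  "graph_iso V E W F \<longleftrightarrow>
     (\<exists>f. bij_betw f V W \<and> (\<forall>u\<in>V. \<forall>v\<in>V. E u v \<longleftrightarrow> F (f u) (f v)))"

text \<open>Complete graph K_n on {0..<n} and complete bipartite graph K_{3,3} on {0..<6}
  with parts {0,1,2} and {3,4,5}.\<close>

definition K_verts :: "nat \<Rightarrow> nat set" where "K_verts n = {0..<n}"
definition K_adj :: "nat \<Rightarrow> nat \<Rightarrow> bool" where "K_adj u v \<longleftrightarrow> u \<noteq> v"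

definition K33_verts :: "nat set" where "K33_verts = {0..<6}"
definition K33_adj :: "nat \<Rightarrow> nat \<Rightarrow> bool" where "K33_adj u v \<longleftrightarrow> (u < 3 \<longleftrightarrow> 3 \<le> v)"

section \<open>Arcs and the two random walks on arcs\<close>

definition arcs :: "'a set \<Rightarrow> ('a \<Rightarrow> 'a \<Rightarrow> bool) \<Rightarrow> ('a \<times> 'a) set" where
  "arcs V E = {(u, v). u \<in> V \<and> v \<in> V \<and> E u v}"

text \<open>A fixed enumeration of the arcs (Kemeny's constant does not depend on it,
  since relabelling states conjugates the transition matrix by a permutation).\<close>

definition arc_list :: "'a set \<Rightarrow> ('a \<Rightarrow> 'a \<Rightarrow> bool) \<Rightarrow> ('a \<times> 'a) list" where
  "arc_list V E = (SOME xs. distinct xs \<and> set xs = arcs V E)"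

text \<open>Edge walk: from (u,v) move to (v,w) with probability 1/deg(v), w any neighbour of v.\<close>

definition edge_walk_matrix :: "'a set \<Rightarrow> ('a \<Rightarrow> 'a \<Rightarrow> bool) \<Rightarrow> complex mat" where
  "edge_walk_matrix V E =
     (let xs = arc_list V E in
      mat (length xs) (length xs) (\<lambda>(i, j).
        if snd (xs ! i) = fst (xs ! j)
        then 1 / of_nat (degree V E (snd (xs ! i))) else 0))"

text \<open>Non-backtracking walk: from (u,v) move to (v,w) with probability 1/(deg(v)-1),
  w any neighbour of v other than u.\<close>

definition nb_walk_matrix :: "'a set \<Rightarrow> ('a \<Rightarrow> 'a \<Rightarrow> bool) \<Rightarrow> complex mat" where
  "nb_walk_matrix V E =
     (let xs = arc_list V E in
      mat (length xs) (length xs) (\<lambda>(i, j).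
        if snd (xs ! i) = fst (xs ! j) \<and> snd (xs ! j) \<noteq> fst (xs ! i)
        then 1 / (of_nat (degree V E (snd (xs ! i))) - 1) else 0))"

definition kemeny_e :: "'a set \<Rightarrow> ('a \<Rightarrow> 'a \<Rightarrow> bool) \<Rightarrow> real" where
  "kemeny_e V E = kemeny (edge_walk_matrix V E)"

definition kemeny_nb :: "'a set \<Rightarrow> ('a \<Rightarrow> 'a \<Rightarrow> bool) \<Rightarrow> real" where
  "kemeny_nb V E = kemeny (nb_walk_matrix V E)"

end

theory Submission
  imports Defs "Jordan_Normal_Form.Schur_Decomposition"
begin

text \<open>
  Let A be the adjacency matrix, with eigenvalues d and l_2, ..., l_n, and let K be Kemeny's
  constant of the walk on vertices, the sum of d / (d - l_i) over i \<ge> 2. Factoring the edge walk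
  through the vertices, and using the Ihara--Bass formula for the non-backtracking walk, gives
  K_e = n (d - 1) + K and
  K_nb = n (d - 1)^2 / d + (d - 1) / (d - 2) + (n - 1) + (1 - 2 / d) K.
  The lower bound is then immediate, and the upper bound is equivalent to
  K > n / 2 + d / (2 (d - 2)).
  The cubic 1 + x + 3 x^2 / 4 + x^3 / 4 is at most 1 / (1 - x) for x < 1, with equality at 0 and
  - 1, the values of l_i / d for K_{3,3}. Summed over x = l_i / d and expressed through the traces
  of A, A^2 and A^3, it yields K \<ge> n - 3 + 3 n / (4 d) + t / (4 d^3), where t counts the closed
  walks of length 3. This suffices except when (n, d) is (4, 3), (5, 4), (6, 3) or (5, 3). The last
  pair is impossible by parity and the first two are K_4 and K_5; for (6, 3) the bound suffices
  as soon as t > 0, and a triangle-free graph of this size is K_{3,3}.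
\<close>

section \<open>Multisets of eigenvalues\<close>

lemma proots_prod_mset_linear:
  fixes M :: "'a :: idom multiset"
  shows "proots (\<Prod>r\<in>#M. [:- r, 1:]) = M"
proof -
  have "0 \<notin># image_mset (\<lambda>r. [:- r, 1:]) M" by auto
  from proots_prod_mset[OF this] show ?thesis by (simp add: multiset.map_comp comp_def)
qed

lemma poly_prod_mset_linear:
  fixes M :: "'a :: idom multiset"
  shows "poly (\<Prod>r\<in>#M. [:- r, 1:]) x = (\<Prod>r\<in>#M. x - r)"
  by (induction M) (simp_all add: algebra_simps)

lemma
  fixes p :: "'a :: alg_closed_field poly"
  assumes "p \<noteq> 0"
  shows size_proots_alg_closed: "size (proots p) = Polynomial.degree p"
    and poly_eq_prod_proots: "poly p x = lead_coeff p * (\<Prod>r\<in>#proots p. x - r)"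
proof -
  obtain M where size: "size M = Polynomial.degree p"
    and factorization: "p = Polynomial.smult (lead_coeff p) (\<Prod>r\<in>#M. [:- r, 1:])"
    using alg_closed_imp_factorization[OF assms] by blast
  have proots: "proots p = M"
    using assms by (subst factorization) (simp add: proots_prod_mset_linear)
  show "size (proots p) = Polynomial.degree p" by (simp add: proots size)
  show "poly p x = lead_coeff p * (\<Prod>r\<in>#proots p. x - r)"
    unfolding proots by (subst factorization) (simp add: poly_prod_mset_linear)
qed

lemma mset_eq_if_prod_diff_eq:
  fixes M N :: "'a :: field_char_0 multiset"
  assumes "\<And>x. (\<Prod>r\<in>#M. x - r) = (\<Prod>r\<in>#N. x - r)"
  shows "M = N"
proof -
  have "(\<Prod>r\<in>#M. [:- r, 1:]) = (\<Prod>r\<in>#N. [:- r, 1:])"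
    using assms by (intro poly_eq_poly_eq_iff[THEN iffD1] ext) (simp add: poly_prod_mset_linear)
  then show ?thesis by (metis proots_prod_mset_linear)
qed

definition eigvals :: "'a :: field mat \<Rightarrow> 'a multiset" where
  "eigvals A = proots (char_poly A)"

lemma char_poly_nonzero: "A \<in> carrier_mat n n \<Longrightarrow> char_poly A \<noteq> 0"
  using degree_monic_char_poly[of A n] by auto

lemma size_eigvals:
  fixes A :: "'a :: alg_closed_field mat"
  assumes "A \<in> carrier_mat n n"
  shows "size (eigvals A) = n"
  using degree_monic_char_poly[OF assms] size_proots_alg_closed[OF char_poly_nonzero[OF assms]]
  by (simp add: eigvals_def)

lemma in_eigvals_iff: "A \<in> carrier_mat n n \<Longrightarrow> e \<in># eigvals A \<longleftrightarrow> eigenvalue A e"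
  by (simp add: eigvals_def eigenvalue_root_char_poly char_poly_nonzero)

lemma det_pencil_eq_prod_eigvals:
  fixes A :: "'a :: alg_closed_field mat"
  assumes A: "A \<in> carrier_mat n n"
  shows "det (x \<cdot>\<^sub>m 1\<^sub>m n - A) = (\<Prod>e\<in>#eigvals A. x - e)"
proof -
  have "det (x \<cdot>\<^sub>m 1\<^sub>m n - A) = poly (char_poly A) x"
    unfolding char_poly_def
    by (rule poly_det_cong[of _ n, symmetric]) (use A in \<open>auto simp: char_poly_matrix_def\<close>)
  also have "\<dots> = (\<Prod>e\<in>#eigvals A. x - e)"
    using poly_eq_prod_proots[OF char_poly_nonzero[OF A]] degree_monic_char_poly[OF A]
    by (simp add: eigvals_def)
  finally show ?thesis .
qed

lemma det_homogeneous_pencil_eq_prod_eigvals: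
  fixes A :: "'a :: alg_closed_field mat"
  assumes A: "A \<in> carrier_mat n n"
  shows "det (x \<cdot>\<^sub>m 1\<^sub>m n - c \<cdot>\<^sub>m A) = (\<Prod>e\<in>#eigvals A. x - c * e)"
proof (cases "c = 0")
  case True
  then have "x \<cdot>\<^sub>m 1\<^sub>m n - c \<cdot>\<^sub>m A = x \<cdot>\<^sub>m 1\<^sub>m n" using A by (intro eq_matI) auto
  then show ?thesis using True size_eigvals[OF A] by simp
next
  case False
  then have "x \<cdot>\<^sub>m 1\<^sub>m n - c \<cdot>\<^sub>m A = c \<cdot>\<^sub>m ((x / c) \<cdot>\<^sub>m 1\<^sub>m n - A)"
    using A by (intro eq_matI) (auto simp: field_simps)
  then have "det (x \<cdot>\<^sub>m 1\<^sub>m n - c \<cdot>\<^sub>m A) = c ^ size (eigvals A) * (\<Prod>e\<in>#eigvals A. x / c - e)"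
    using A by (simp add: det_pencil_eq_prod_eigvals size_eigvals)
  also have "\<dots> = (\<Prod>e\<in>#eigvals A. c * (x / c - e))"
    by (simp add: prod_mset.distrib)
  finally show ?thesis using False by (simp add: right_diff_distrib)
qed

lemma eigvals_smult:
  fixes A :: "'a :: {alg_closed_field, field_char_0} mat"
  assumes "A \<in> carrier_mat n n"
  shows "eigvals (c \<cdot>\<^sub>m A) = image_mset ((*) c) (eigvals A)"
  using assms
  by (intro mset_eq_if_prod_diff_eq)
    (simp add: det_homogeneous_pencil_eq_prod_eigvals multiset.map_comp comp_def
      flip: det_pencil_eq_prod_eigvals[of _ n])

lemma sylvester_determinant_identity:
  fixes A B :: "'a :: idom mat"
  assumes A: "A \<in> carrier_mat m n" and B: "B \<in> carrier_mat n m"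
  shows "x ^ n * det (x \<cdot>\<^sub>m 1\<^sub>m m - A * B) = x ^ m * det (x \<cdot>\<^sub>m 1\<^sub>m n - B * A)"
proof -
  let ?M = "four_block_mat (x \<cdot>\<^sub>m 1\<^sub>m m) A B (1\<^sub>m n)"
  let ?R = "four_block_mat (1\<^sub>m m) (0\<^sub>m m n) (- B) (1\<^sub>m n)"
  let ?L = "four_block_mat (1\<^sub>m m) (0\<^sub>m m n) (- B) (x \<cdot>\<^sub>m 1\<^sub>m n)"
  have M: "?M \<in> carrier_mat (m + n) (m + n)" using A B by auto
  have R: "?R \<in> carrier_mat (m + n) (m + n)" and L: "?L \<in> carrier_mat (m + n) (m + n)"
    using B by auto
  have "?M * ?R = four_block_mat (x \<cdot>\<^sub>m 1\<^sub>m m - A * B) A (0\<^sub>m n m) (1\<^sub>m n)"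
    by (subst mult_four_block_mat[of _ m m _ n _ n])
      (use A B in \<open>auto simp: minus_add_uminus_mat intro!: cong_four_block_mat\<close>)
  then have "det ?M * det ?R = det (x \<cdot>\<^sub>m 1\<^sub>m m - A * B)"
    using det_mult[OF M R] A B
      det_four_block_mat_lower_left_zero[of "x \<cdot>\<^sub>m 1\<^sub>m m - A * B" m A n "0\<^sub>m n m" "1\<^sub>m n"]
    by (auto simp: minus_carrier_mat)
  moreover have "det ?R = 1"
    using det_four_block_mat_upper_right_zero[of "1\<^sub>m m" m "0\<^sub>m m n" n "- B" "1\<^sub>m n"] B by auto
  moreover have "?L * ?M = four_block_mat (x \<cdot>\<^sub>m 1\<^sub>m m) A (0\<^sub>m n m) (x \<cdot>\<^sub>m 1\<^sub>m n - B * A)"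
    by (subst mult_four_block_mat[of _ m m _ n _ n])
      (use A B in \<open>auto intro!: cong_four_block_mat\<close>)
  then have "det ?L * det ?M = x ^ m * det (x \<cdot>\<^sub>m 1\<^sub>m n - B * A)"
    using det_mult[OF L M] A B
      det_four_block_mat_lower_left_zero[of "x \<cdot>\<^sub>m 1\<^sub>m m" m A n "0\<^sub>m n m" "x \<cdot>\<^sub>m 1\<^sub>m n - B * A"]
    by (auto simp: minus_carrier_mat)
  moreover have "det ?L = x ^ n"
    using det_four_block_mat_upper_right_zero[of "1\<^sub>m m" m "0\<^sub>m m n" n "- B" "x \<cdot>\<^sub>m 1\<^sub>m n"] B by auto
  ultimately show ?thesis by simp
qed

lemma eigvals_mult_swap:
  fixes A B :: "'a :: {alg_closed_field, field_char_0} mat"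
  assumes A: "A \<in> carrier_mat m n" and B: "B \<in> carrier_mat n m"
  shows "replicate_mset n 0 + eigvals (A * B) = replicate_mset m 0 + eigvals (B * A)"
proof (rule mset_eq_if_prod_diff_eq)
  fix x
  show "(\<Prod>r\<in>#replicate_mset n 0 + eigvals (A * B). x - r)
      = (\<Prod>r\<in>#replicate_mset m 0 + eigvals (B * A). x - r)"
    using sylvester_determinant_identity[OF A B, of x]
      det_pencil_eq_prod_eigvals[OF mult_carrier_mat[OF A B], of x]
      det_pencil_eq_prod_eigvals[OF mult_carrier_mat[OF B A], of x] by simp
qed

lemma det_scalar_minus_rank_one:
  fixes v w :: "'a :: idom mat"
  assumes v: "v \<in> carrier_mat n 1" and w: "w \<in> carrier_mat 1 n"
  shows "x * det (x \<cdot>\<^sub>m 1\<^sub>m n - v * w) = x ^ n * (x - (w * v) $$ (0, 0))"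
proof -
  have "det (x \<cdot>\<^sub>m 1\<^sub>m 1 - w * v) = x - (w * v) $$ (0, 0)"
    using v w by (subst det_single) (auto simp del: index_mult_mat(1))
  then show ?thesis using sylvester_determinant_identity[OF v w, of x] by simp
qed

lemma pencil_mult_scalar_minus_rank_one:
  fixes A v w :: "'a :: comm_ring_1 mat"
  assumes A: "A \<in> carrier_mat n n" and v: "v \<in> carrier_mat n 1" and w: "w \<in> carrier_mat 1 n"
    and eigenvector: "A * v = c \<cdot>\<^sub>m v"
  shows "(x \<cdot>\<^sub>m 1\<^sub>m n - A) * ((x - c) \<cdot>\<^sub>m 1\<^sub>m n - v * w) = (x - c) \<cdot>\<^sub>m (x \<cdot>\<^sub>m 1\<^sub>m n - (A + v * w))"
proof -
  let ?X = "x \<cdot>\<^sub>m 1\<^sub>m n - A"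
  have X: "?X \<in> carrier_mat n n" using A by (rule minus_carrier_mat)
  have vw: "v * w \<in> carrier_mat n n" using v w by (rule mult_carrier_mat)
  have "?X * v = x \<cdot>\<^sub>m v - A * v"
    using A v by (simp add: minus_mult_distrib_mat[of _ n n] mult_smult_assoc_mat[of _ n n])
  also have "\<dots> = (x - c) \<cdot>\<^sub>m v"
    unfolding eigenvector by (rule eq_matI) (auto simp: algebra_simps)
  finally have "?X * (v * w) = (x - c) \<cdot>\<^sub>m (v * w)"
    using assoc_mult_mat[OF X v w] mult_smult_assoc_mat[OF v w, of "x - c"] by simp
  then have "?X * ((x - c) \<cdot>\<^sub>m 1\<^sub>m n - v * w) = (x - c) \<cdot>\<^sub>m ?X - (x - c) \<cdot>\<^sub>m (v * w)"
    using mult_minus_distrib_mat[OF X smult_carrier_mat[OF one_carrier_mat] vw, of "x - c"]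
      mult_smult_distrib[OF X one_carrier_mat, of "x - c"] right_mult_one_mat[OF X] by simp
  also have "\<dots> = (x - c) \<cdot>\<^sub>m (x \<cdot>\<^sub>m 1\<^sub>m n - (A + v * w))"
    using A v w by (intro eq_matI) (auto simp: algebra_simps simp del: index_mult_mat(1))
  finally show ?thesis .
qed

lemma eigvals_rank_one_update:
  fixes A v w :: "'a :: {alg_closed_field, field_char_0} mat"
  assumes A: "A \<in> carrier_mat n n" and v: "v \<in> carrier_mat n 1" and w: "w \<in> carrier_mat 1 n"
    and eigenvector: "A * v = c \<cdot>\<^sub>m v"
  shows "add_mset c (eigvals (A + v * w)) = add_mset (c + (w * v) $$ (0, 0)) (eigvals A)"
proof -
  let ?s = "(w * v) $$ (0, 0)"
  have vw: "v * w \<in> carrier_mat n n" using v w by (rule mult_carrier_mat)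
  have "replicate_mset n c + add_mset c (eigvals (A + v * w))
      = replicate_mset n c + add_mset (c + ?s) (eigvals A)"
  proof (rule mset_eq_if_prod_diff_eq)
    fix x
    let ?X = "x \<cdot>\<^sub>m 1\<^sub>m n - A" and ?Y = "(x - c) \<cdot>\<^sub>m 1\<^sub>m n - v * w"
    have X: "?X \<in> carrier_mat n n" using A by (rule minus_carrier_mat)
    have Y: "?Y \<in> carrier_mat n n" using vw by (rule minus_carrier_mat)
    have "det ?X * det ?Y = (x - c) ^ n * det (x \<cdot>\<^sub>m 1\<^sub>m n - (A + v * w))"
      using det_mult[OF X Y] A v w unfolding pencil_mult_scalar_minus_rank_one[OF assms] by simp
    then have "(x - c) ^ n * ((x - c) * det (x \<cdot>\<^sub>m 1\<^sub>m n - (A + v * w))) = det ?X * ((x - c) * det ?Y)"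
      by (simp add: mult.left_commute)
    also have "\<dots> = (x - c) ^ n * ((x - (c + ?s)) * det ?X)"
      unfolding det_scalar_minus_rank_one[OF v w] by (simp add: diff_diff_eq)
    finally show "(\<Prod>r\<in>#replicate_mset n c + add_mset c (eigvals (A + v * w)). x - r)
        = (\<Prod>r\<in>#replicate_mset n c + add_mset (c + ?s) (eigvals A). x - r)"
      using det_pencil_eq_prod_eigvals[OF A, of x]
        det_pencil_eq_prod_eigvals[OF add_carrier_mat[OF vw, of A], of x] by simp
  qed
  then show ?thesis by simp
qed

definition trace :: "'a :: comm_monoid_add mat \<Rightarrow> 'a" where
  "trace A = (\<Sum>i<dim_row A. A $$ (i, i))"

lemma trace_mult_swap:
  fixes A B :: "'a :: comm_semiring_0 mat"
  assumes "A \<in> carrier_mat m n" "B \<in> carrier_mat n m"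
  shows "trace (A * B) = trace (B * A)"
proof -
  have "trace (A * B) = (\<Sum>i<m. \<Sum>j<n. A $$ (i, j) * B $$ (j, i))"
    using assms by (auto simp: trace_def scalar_prod_def lessThan_atLeast0 intro!: sum.cong)
  also have "\<dots> = (\<Sum>j<n. \<Sum>i<m. A $$ (i, j) * B $$ (j, i))" by (rule sum.swap)
  also have "\<dots> = trace (B * A)"
    using assms
    by (auto simp: trace_def scalar_prod_def lessThan_atLeast0 mult.commute intro!: sum.cong)
  finally show ?thesis .
qed

lemma upper_triangular_mult:
  fixes A B :: "'a :: semiring_0 mat"
  assumes A: "A \<in> carrier_mat n n" "upper_triangular A"
    and B: "B \<in> carrier_mat n n" "upper_triangular B"
  shows "upper_triangular (A * B)" "\<And>i. i < n \<Longrightarrow> (A * B) $$ (i, i) = A $$ (i, i) * B $$ (i, i)"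
proof -
  have vanish: "A $$ (i, k) * B $$ (k, j) = 0" if "i < n" "k < n" "j \<le> i" "k \<noteq> i \<or> j \<noteq> i" for i j k
    using that A B upper_triangularD[OF A(2)] upper_triangularD[OF B(2)] by (cases "k < i") auto
  show "upper_triangular (A * B)"
    using A(1) B(1) vanish by (intro upper_triangularI) (auto simp: scalar_prod_def intro!: sum.neutral)
  fix i assume i: "i < n"
  have "(A * B) $$ (i, i) = (\<Sum>k\<in>{0..<n}. A $$ (i, k) * B $$ (k, i))"
    using A(1) B(1) i by (auto simp: scalar_prod_def)
  also have "\<dots> = (\<Sum>k\<in>{i}. A $$ (i, k) * B $$ (k, i))"
    by (rule sum.mono_neutral_right) (use i vanish in auto)
  finally show "(A * B) $$ (i, i) = A $$ (i, i) * B $$ (i, i)" by simp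
qed

lemma upper_triangular_pow:
  fixes A :: "'a :: semiring_1 mat"
  assumes A: "A \<in> carrier_mat n n" "upper_triangular A"
  shows "upper_triangular (A ^\<^sub>m k) \<and> (\<forall>i<n. (A ^\<^sub>m k) $$ (i, i) = A $$ (i, i) ^ k)"
proof (induction k)
  case 0
  then show ?case using A by auto
next
  case (Suc k)
  from upper_triangular_mult[OF pow_carrier_mat[OF A(1)] _ A] Suc show ?case
    by (auto simp: power_commutes)
qed

lemma trace_pow_eq_sum_eigvals:
  fixes A :: "complex mat"
  assumes A: "A \<in> carrier_mat n n"
  shows "trace (A ^\<^sub>m k) = (\<Sum>e\<in>#eigvals A. e ^ k)"
proof -
  obtain es where es: "char_poly A = (\<Prod>e\<leftarrow>es. [:- e, 1:])"
    using char_poly_factorized[OF A] by blast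
  have eigvals: "eigvals A = mset es"
    using proots_prod_mset_linear[of "mset es"]
    by (simp add: eigvals_def es prod_mset_prod_list flip: mset_map)
  obtain B P Q where "schur_decomposition A es = (B, P, Q)"
    by (cases "schur_decomposition A es") auto
  from schur_decomposition[OF A es this]
  have sim: "similar_mat_wit A B P Q" and triangular: "upper_triangular B" and diag: "diag_mat B = es"
    by auto
  from similar_mat_witD2[OF A sim] have B: "B \<in> carrier_mat n n" and P: "P \<in> carrier_mat n n"
    and Q: "Q \<in> carrier_mat n n" and QP: "Q * P = 1\<^sub>m n" by auto
  have Bk: "B ^\<^sub>m k \<in> carrier_mat n n" using B by simp
  have "trace (A ^\<^sub>m k) = trace (P * (B ^\<^sub>m k * Q))"
    using similar_mat_wit_pow_id[OF sim, of k] assoc_mult_mat[OF P Bk Q] by simp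
  also have "\<dots> = trace (B ^\<^sub>m k * (Q * P))"
    using trace_mult_swap[OF P mult_carrier_mat[OF Bk Q]] assoc_mult_mat[OF Bk Q P] by simp
  also have "\<dots> = (\<Sum>i<n. B $$ (i, i) ^ k)"
    using upper_triangular_pow[OF B triangular] Bk B by (simp add: QP trace_def)
  also have "\<dots> = (\<Sum>e\<leftarrow>diag_mat B. e ^ k)"
    using B by (simp add: diag_mat_def sum_list_distinct_conv_sum_set comp_def lessThan_atLeast0)
  finally show ?thesis by (simp add: diag eigvals sum_mset_sum_list flip: mset_map)
qed

lemma involution_eigenvalue:
  fixes R :: "'a :: field mat"
  assumes R: "R \<in> carrier_mat n n" and involution: "R * R = 1\<^sub>m n" and "eigenvalue R e"
  shows "e = 1 \<or> e = - 1"
proof -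
  obtain x where x: "x \<in> carrier_vec n" "x \<noteq> 0\<^sub>v n" "R *\<^sub>v x = e \<cdot>\<^sub>v x"
    using \<open>eigenvalue R e\<close> R by (auto simp: eigenvalue_def eigenvector_def)
  have "x = (R * R) *\<^sub>v x" using x(1) by (simp add: involution)
  also have "\<dots> = (e * e) \<cdot>\<^sub>v x"
    using R x by (simp add: assoc_mult_mat_vec[of _ n n] mult_mat_vec[of _ n n] smult_smult_assoc)
  finally have fixed: "x = (e * e) \<cdot>\<^sub>v x" .
  obtain i where i: "i < n" "x $ i \<noteq> 0" using x by (metis carrier_vecD eq_vecI index_zero_vec)
  then have "e * e * x $ i = ((e * e) \<cdot>\<^sub>v x) $ i" using x(1) by simp
  also have "\<dots> = x $ i" by (simp only: flip: fixed)
  finally show ?thesis using i(2) by (simp add: square_eq_1_iff)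
qed

lemma eigvals_traceless_involution:
  fixes R :: "complex mat"
  assumes R: "R \<in> carrier_mat n n" and involution: "R * R = 1\<^sub>m n" and traceless: "trace R = 0"
  shows "even n" "eigvals R = replicate_mset (n div 2) 1 + replicate_mset (n div 2) (- 1)"
proof -
  define p where "p = count (eigvals R) 1"
  define m where "m = count (eigvals R) (- 1)"
  have "e = 1 \<or> e = - 1" if "e \<in># eigvals R" for e
    using involution_eigenvalue[OF R involution] that in_eigvals_iff[OF R] by blast
  then have eigvals_R: "eigvals R = replicate_mset p 1 + replicate_mset m (- 1)"
    by (intro multiset_eqI) (auto simp: p_def m_def count_eq_zero_iff)
  have "trace R = (\<Sum>e\<in>#eigvals R. e)"
    using trace_pow_eq_sum_eigvals[OF R, of 1] left_mult_one_mat[OF R] R by simp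
  also have "\<dots> = of_nat p - of_nat m" by (simp add: eigvals_R)
  finally have "m = p" using traceless by simp
  moreover from this have "n = 2 * p"
    using arg_cong[OF eigvals_R, of size] size_eigvals[OF R] by simp
  ultimately show "even n" "eigvals R = replicate_mset (n div 2) 1 + replicate_mset (n div 2) (- 1)"
    using eigvals_R by auto
qed

section \<open>Matrices of kernels\<close>

definition kernel_mat :: "'b list \<Rightarrow> 'c list \<Rightarrow> ('b \<Rightarrow> 'c \<Rightarrow> 'a) \<Rightarrow> 'a mat" where
  "kernel_mat xs ys K = mat (length xs) (length ys) (\<lambda>(i, j). K (xs ! i) (ys ! j))"

lemma kernel_mat_carrier [simp]: "kernel_mat xs ys K \<in> carrier_mat (length xs) (length ys)"
  by (simp add: kernel_mat_def)

lemma kernel_mat_cong: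
  "(\<And>x y. x \<in> set xs \<Longrightarrow> y \<in> set ys \<Longrightarrow> K x y = L x y) \<Longrightarrow> kernel_mat xs ys K = kernel_mat xs ys L"
  by (rule eq_matI) (auto simp: kernel_mat_def)

lemma sum_nth_distinct: "distinct xs \<Longrightarrow> (\<Sum>i<length xs. f (xs ! i)) = (\<Sum>x\<in>set xs. f x)"
  using sum.reindex_bij_betw[OF bij_betw_nth] by blast

lemma kernel_mat_mult:
  fixes K :: "'b \<Rightarrow> 'c \<Rightarrow> 'a :: semiring_0"
  assumes "distinct ys"
  shows "kernel_mat xs ys K * kernel_mat ys zs L = kernel_mat xs zs (\<lambda>x z. \<Sum>y\<in>set ys. K x y * L y z)"
  by (rule eq_matI)
    (auto simp: kernel_mat_def scalar_prod_def lessThan_atLeast0 simp flip: sum_nth_distinct[OF assms])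

lemma kernel_mat_smult: "c \<cdot>\<^sub>m kernel_mat xs ys K = kernel_mat xs ys (\<lambda>x y. c * K x y)"
  by (rule eq_matI) (auto simp: kernel_mat_def)

lemma kernel_mat_add: "kernel_mat xs ys K + kernel_mat xs ys L = kernel_mat xs ys (\<lambda>x y. K x y + L x y)"
  by (rule eq_matI) (auto simp: kernel_mat_def)

lemma kernel_mat_minus: "kernel_mat xs ys K - kernel_mat xs ys L = kernel_mat xs ys (\<lambda>x y. K x y - L x y)"
  by (rule eq_matI) (auto simp: kernel_mat_def)

lemma one_mat_eq_kernel_mat: "distinct xs \<Longrightarrow> 1\<^sub>m (length xs) = kernel_mat xs xs (\<lambda>x y. of_bool (x = y))"
  by (rule eq_matI) (auto simp: kernel_mat_def nth_eq_iff_index_eq)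

lemma trace_kernel_mat: "distinct xs \<Longrightarrow> trace (kernel_mat xs xs K) = (\<Sum>x\<in>set xs. K x x)"
  by (simp add: trace_def kernel_mat_def flip: sum_nth_distinct)

lemma eigenvalue_kernel_matE:
  fixes K :: "'b \<Rightarrow> 'b \<Rightarrow> 'a :: field"
  assumes "eigenvalue (kernel_mat xs xs K) e" and xs: "distinct xs"
  obtains f where "\<exists>x\<in>set xs. f x \<noteq> 0" "\<And>x. x \<in> set xs \<Longrightarrow> (\<Sum>y\<in>set xs. K x y * f y) = e * f x"
proof -
  from assms obtain v where v: "v \<in> carrier_vec (length xs)" "v \<noteq> 0\<^sub>v (length xs)"
    "kernel_mat xs xs K *\<^sub>v v = e \<cdot>\<^sub>v v"
    by (auto simp: eigenvalue_def eigenvector_def kernel_mat_def)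
  define f where "f x = v $ (the_inv_into {..<length xs} ((!) xs) x)" for x
  have f: "f (xs ! i) = v $ i" if "i < length xs" for i
    using that xs by (simp add: f_def the_inv_into_f_f inj_on_nth)
  show ?thesis
  proof
    obtain i where "i < length xs" "v $ i \<noteq> 0" using v by (metis carrier_vecD eq_vecI index_zero_vec)
    then show "\<exists>x\<in>set xs. f x \<noteq> 0" using f nth_mem by metis
    fix x assume "x \<in> set xs"
    then obtain i where i: "i < length xs" "x = xs ! i" by (metis in_set_conv_nth)
    have "(\<Sum>y\<in>set xs. K x y * f y) = (kernel_mat xs xs K *\<^sub>v v) $ i"
      using i v(1) f
      by (simp add: kernel_mat_def scalar_prod_def lessThan_atLeast0 flip: sum_nth_distinct[OF xs])
    then show "(\<Sum>y\<in>set xs. K x y * f y) = e * f x" using i v f by simp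
  qed
qed

lemma hermitian_kernel_eigenvalue_real:
  fixes f :: "'a \<Rightarrow> complex"
  assumes "finite X" and nonzero: "\<exists>x\<in>X. f x \<noteq> 0"
    and eigen: "\<And>x. x \<in> X \<Longrightarrow> (\<Sum>y\<in>X. K x y * f y) = e * f x"
    and hermitian: "\<And>x y. K y x = cnj (K x y)"
  shows "e \<in> \<real>"
proof -
  define r where "r = (\<Sum>x\<in>X. (cmod (f x))\<^sup>2)"
  define S where "S = (\<Sum>x\<in>X. \<Sum>y\<in>X. cnj (f x) * K x y * f y)"
  have r: "r > 0"
    using nonzero \<open>finite X\<close> by (auto simp: r_def intro: sum_pos2)
  have "S = (\<Sum>x\<in>X. cnj (f x) * (\<Sum>y\<in>X. K x y * f y))"
    by (simp add: S_def sum_distrib_left mult.assoc)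
  also have "\<dots> = (\<Sum>x\<in>X. e * of_real ((cmod (f x))\<^sup>2))"
    by (rule sum.cong) (simp_all only: eigen complex_norm_square, simp add: mult_ac)
  also have "\<dots> = e * of_real r"
    by (simp add: r_def sum_distrib_left)
  finally have S: "S = e * of_real r" .
  have "cnj S = (\<Sum>x\<in>X. \<Sum>y\<in>X. cnj (f y) * K y x * f x)"
    by (simp add: S_def mult_ac flip: hermitian)
  also have "\<dots> = S" unfolding S_def by (rule sum.swap)
  finally have "cnj e * of_real r = e * of_real r" by (simp add: S)
  then show ?thesis using r by (simp add: Reals_cnj_iff)
qed

section \<open>Kemeny's constant as a sum over eigenvalues\<close>

definition resolvent_sum :: "complex \<Rightarrow> complex multiset \<Rightarrow> complex" where
  "resolvent_sum c M = (\<Sum>e\<in>#M. c / (c - e))"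

lemma resolvent_sum_simps [simp]:
  "resolvent_sum c {#} = 0"
  "resolvent_sum c (add_mset e M) = c / (c - e) + resolvent_sum c M"
  "resolvent_sum c (M + N) = resolvent_sum c M + resolvent_sum c N"
  "resolvent_sum c (replicate_mset k e) = of_nat k * (c / (c - e))"
  by (simp_all add: resolvent_sum_def)

text \<open>Since 1 / 0 = 0, the eigenvalue 1 contributes nothing, whether or not it is removed.\<close>

lemma kemeny_eq_resolvent_sum: "kemeny P = Re (resolvent_sum 1 (eigvals P))"
proof (cases "1 \<in># eigvals P")
  case True
  then obtain M where "eigvals P = add_mset 1 M" by (metis mset_add)
  then show ?thesis by (simp add: kemeny_def resolvent_sum_def eigvals_def)
qed (simp add: kemeny_def resolvent_sum_def eigvals_def)

lemma kemeny_smult_inverse: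
  assumes "A \<in> carrier_mat n n" "c \<noteq> 0"
  shows "kemeny ((1 / c) \<cdot>\<^sub>m A) = Re (resolvent_sum c (eigvals A))"
proof -
  have "1 / (1 - 1 / c * e) = c / (c - e)" for e using assms(2) by (simp add: field_simps)
  then show ?thesis
    by (simp add: kemeny_eq_resolvent_sum eigvals_smult[OF assms(1)] resolvent_sum_def
        multiset.map_comp comp_def)
qed

lemma proots_quadratic: "proots [:a * b, - (a + b), 1:] = {#a, b :: 'a :: idom#}"
proof -
  have "[:a * b, - (a + b), 1:] = [:- a, 1:] * [:- b, 1:]" by (simp add: algebra_simps)
  then show ?thesis by (simp only:) (subst proots_mult, auto)
qed

lemma complex_sum_product_exists: "\<exists>a b :: complex. a + b = s \<and> a * b = p"
proof (intro exI conjI)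
  let ?r = "csqrt (s\<^sup>2 - 4 * p)"
  show "(s + ?r) / 2 + (s - ?r) / 2 = s" by (simp add: field_simps)
  have "(s + ?r) / 2 * ((s - ?r) / 2) = (s\<^sup>2 - ?r\<^sup>2) / 4" by (simp add: power2_eq_square algebra_simps)
  then show "(s + ?r) / 2 * ((s - ?r) / 2) = p" by simp
qed

lemma resolvent_sum_quadratic:
  assumes "c\<^sup>2 - s * c + p \<noteq> 0"
  shows "resolvent_sum c (proots [:p, - s, 1:]) = c * (2 * c - s) / (c\<^sup>2 - s * c + p)"
proof -
  obtain a b where ab: "s = a + b" "p = a * b" using complex_sum_product_exists by metis
  have "c\<^sup>2 - s * c + p = (c - a) * (c - b)" by (simp add: ab power2_eq_square algebra_simps)
  with assms have "c \<noteq> a" "c \<noteq> b" by auto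
  then have "c / (c - a) + c / (c - b) = c * (2 * c - (a + b)) / ((c - a) * (c - b))"
    by (simp add: divide_simps) (simp add: algebra_simps)
  then show ?thesis
    unfolding \<open>c\<^sup>2 - s * c + p = (c - a) * (c - b)\<close> unfolding ab proots_quadratic by simp
qed

lemma resolvent_sum_sum_mset: "resolvent_sum c (\<Sum>x\<in>#M. F x) = (\<Sum>x\<in>#M. resolvent_sum c (F x))"
  by (induction M) auto

lemma resolvent_sum_ihara_factor:
  assumes "c \<noteq> 0" "e \<noteq> c + 1"
  shows "resolvent_sum c (proots [:c, - e, 1:]) = 1 + (c - 1) / (c + 1 - e)"
proof -
  have "c\<^sup>2 - e * c + c = c * (c + 1 - e)" by (simp add: power2_eq_square algebra_simps)
  moreover have "c + 1 - e \<noteq> 0" using assms(2) by auto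
  ultimately have "resolvent_sum c (proots [:c, - e, 1:]) = (2 * c - e) / (c + 1 - e)"
    using assms(1) by (simp add: resolvent_sum_quadratic)
  then show ?thesis using \<open>c + 1 - e \<noteq> 0\<close> by (simp add: field_simps)
qed

lemma resolvent_sum_ihara_factors:
  assumes "c \<noteq> 0" "c \<noteq> - 1" and "\<And>e. e \<in># M \<Longrightarrow> e \<noteq> c + 1"
  shows "(\<Sum>e\<in>#M. resolvent_sum c (proots [:c, - e, 1:]))
    = of_nat (size M) + (c - 1) / (c + 1) * resolvent_sum (c + 1) M"
proof -
  have "(\<Sum>e\<in>#M. resolvent_sum c (proots [:c, - e, 1:])) = (\<Sum>e\<in>#M. 1 + (c - 1) / (c + 1 - e))"
    using assms by (intro arg_cong[of _ _ sum_mset] image_mset_cong resolvent_sum_ihara_factor)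
  also have "\<dots> = of_nat (size M) + (c - 1) / (c + 1) * resolvent_sum (c + 1) M"
    using assms(2) by (induction M) (auto simp: field_simps add_eq_0_iff)
  finally show ?thesis .
qed

lemma resolvent_sum_ihara_factor_trivial: "resolvent_sum c (proots [:c, - (c + 1), 1:]) = c / (c - 1)"
  using proots_quadratic[of c 1] by simp

section \<open>The spectrum of a regular graph\<close>

lemma sum_of_bool_delta:
  fixes g :: "'b \<Rightarrow> 'c :: semiring_1"
  assumes "finite S" "x \<in> S"
  shows "(\<Sum>y\<in>S. of_bool (x = y) * g y) = g x"
proof -
  have "S \<inter> {y. x = y} = {x}" using assms(2) by auto
  then show ?thesis using assms(1) by simp
qed

lemma finite_enumeration:
  assumes "finite A"
  shows "distinct (SOME xs. distinct xs \<and> set xs = A)" "set (SOME xs. distinct xs \<and> set xs = A) = A"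
proof -
  have "\<exists>xs. distinct xs \<and> set xs = A" using finite_distinct_list[OF assms] by blast
  from someI_ex[OF this] show "distinct (SOME xs. distinct xs \<and> set xs = A)"
    "set (SOME xs. distinct xs \<and> set xs = A) = A" by auto
qed

locale regular_graph =
  fixes V :: "'a set" and E :: "'a \<Rightarrow> 'a \<Rightarrow> bool" and d :: nat
  assumes simple: "simple_graph V E" and regular: "regular V E d"
begin

abbreviation n :: nat where "n \<equiv> card V"

definition nbrs :: "'a \<Rightarrow> 'a set" where "nbrs v = {w. E v w}"

definition verts :: "'a list" where "verts = (SOME vs. distinct vs \<and> set vs = V)"

definition adj :: "complex mat" where
  "adj = kernel_mat verts verts (\<lambda>u v. of_bool (E u v))"

lemma finite_V: "finite V"
  and E_sym: "E u v \<Longrightarrow> E v u"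
  and E_irrefl: "\<not> E u u"
  and E_imp_V: "E u v \<Longrightarrow> u \<in> V" "E u v \<Longrightarrow> v \<in> V"
  using simple by (auto simp: simple_graph_def)

lemma E_commute: "E u v \<longleftrightarrow> E v u"
  using E_sym by blast

lemma distinct_verts: "distinct verts" and set_verts: "set verts = V"
  unfolding verts_def by (rule finite_enumeration[OF finite_V])+

lemma length_verts [simp]: "length verts = n"
  using distinct_card[OF distinct_verts] by (simp add: set_verts)

lemma adj_carrier [simp]: "adj \<in> carrier_mat n n"
  using kernel_mat_carrier[of verts verts] by (simp add: adj_def)

lemma V_Int_nbrs: "V \<inter> {w. E v w} = nbrs v"
  using E_imp_V by (auto simp: nbrs_def)

lemma finite_nbrs: "finite (nbrs v)"
  using finite_V by (simp flip: V_Int_nbrs)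

lemma card_nbrs: "v \<in> V \<Longrightarrow> card (nbrs v) = d"
  using regular by (simp add: regular_def degree_def Collect_conj_eq V_Int_nbrs)

lemma sum_adjacency:
  fixes f :: "'a \<Rightarrow> 'b :: semiring_1"
  shows "(\<Sum>w\<in>V. of_bool (E v w) * f w) = (\<Sum>w\<in>nbrs v. f w)"
  using finite_V by (simp add: V_Int_nbrs)

lemma sum_nbrs_indicator: "(\<Sum>w\<in>nbrs u. of_bool (w = v)) = (of_bool (E u v) :: 'b :: semiring_1)"
proof -
  have "nbrs u \<inter> {w. w = v} = (if E u v then {v} else {})" by (auto simp: nbrs_def)
  then show ?thesis using finite_nbrs[of u] by simp
qed

lemma sum_nbrs_swap:
  fixes g :: "'a \<Rightarrow> 'a \<Rightarrow> 'b :: semiring_1"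
  shows "(\<Sum>v\<in>V. \<Sum>w\<in>nbrs v. g v w) = (\<Sum>v\<in>V. \<Sum>w\<in>nbrs v. g w v)"
proof -
  have "(\<Sum>v\<in>V. \<Sum>w\<in>nbrs v. g v w) = (\<Sum>w\<in>V. \<Sum>v\<in>V. of_bool (E v w) * g v w)"
    unfolding sum_adjacency[symmetric] by (rule sum.swap)
  also have "\<dots> = (\<Sum>w\<in>V. \<Sum>v\<in>V. of_bool (E w v) * g v w)"
    by (simp only: E_commute)
  finally show ?thesis unfolding sum_adjacency .
qed

lemma adj_eigenfunction:
  assumes "eigenvalue adj e"
  obtains f where "\<exists>v\<in>V. f v \<noteq> 0" "\<And>v. v \<in> V \<Longrightarrow> (\<Sum>w\<in>nbrs v. f w) = e * f v"
  using eigenvalue_kernel_matE[OF assms[unfolded adj_def] distinct_verts]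
  unfolding set_verts sum_adjacency by metis

lemma dirichlet_form_eigenfunction:
  fixes f :: "'a \<Rightarrow> complex"
  assumes eigen: "\<And>v. v \<in> V \<Longrightarrow> (\<Sum>w\<in>nbrs v. f w) = e * f v"
  shows "(\<Sum>v\<in>V. \<Sum>w\<in>nbrs v. (cmod (f v - f w))\<^sup>2) = 2 * (real d - Re e) * (\<Sum>v\<in>V. (cmod (f v))\<^sup>2)"
proof -
  define r where "r = (\<Sum>v\<in>V. (cmod (f v))\<^sup>2)"
  have expand: "(cmod (a - b))\<^sup>2 = (cmod a)\<^sup>2 + (cmod b)\<^sup>2 - 2 * Re (cnj a * b)" for a b
    unfolding cmod_power2 by (simp add: power2_eq_square algebra_simps)
  have source: "(\<Sum>v\<in>V. \<Sum>w\<in>nbrs v. (cmod (f v))\<^sup>2) = real d * r"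
    by (simp add: card_nbrs r_def sum_distrib_left)
  then have target: "(\<Sum>v\<in>V. \<Sum>w\<in>nbrs v. (cmod (f w))\<^sup>2) = real d * r"
    by (subst sum_nbrs_swap)
  have "(\<Sum>w\<in>nbrs v. Re (cnj (f v) * f w)) = Re e * (cmod (f v))\<^sup>2" if "v \<in> V" for v
  proof -
    have "(\<Sum>w\<in>nbrs v. Re (cnj (f v) * f w)) = Re (cnj (f v) * (e * f v))"
      unfolding eigen[OF that, symmetric] sum_distrib_left Re_sum ..
    also have "\<dots> = Re e * (cmod (f v))\<^sup>2"
      unfolding cmod_power2 by (simp add: power2_eq_square algebra_simps)
    finally show ?thesis .
  qed
  then have cross: "(\<Sum>v\<in>V. \<Sum>w\<in>nbrs v. 2 * Re (cnj (f v) * f w)) = 2 * (Re e * r)"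
    by (simp add: r_def sum_distrib_left[symmetric] del: complex_cnj_mult times_complex.simps)
  show ?thesis
    unfolding expand sum.distrib sum_subtractf source target cross r_def[symmetric]
    by (simp add: algebra_simps)
qed

lemma eigenvalue_adj_real:
  assumes "eigenvalue adj e"
  shows "e \<in> \<real>"
proof -
  obtain f where "\<exists>v\<in>V. f v \<noteq> 0" "\<And>v. v \<in> V \<Longrightarrow> (\<Sum>w\<in>V. of_bool (E v w) * f w) = e * f v"
    using adj_eigenfunction[OF assms] unfolding sum_adjacency by metis
  then show ?thesis
    by (rule hermitian_kernel_eigenvalue_real[OF finite_V]) (auto simp: E_commute)
qed

lemma eigenvalue_adj_le:
  assumes "eigenvalue adj e"
  shows "Re e \<le> real d"
proof -
  obtain f where nonzero: "\<exists>v\<in>V. f v \<noteq> 0"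
    and eigen: "\<And>v. v \<in> V \<Longrightarrow> (\<Sum>w\<in>nbrs v. f w) = e * f v"
    using adj_eigenfunction[OF assms] by metis
  have "0 < (\<Sum>v\<in>V. (cmod (f v))\<^sup>2)"
    using nonzero finite_V by (auto intro: sum_pos2)
  moreover have "0 \<le> (\<Sum>v\<in>V. \<Sum>w\<in>nbrs v. (cmod (f v - f w))\<^sup>2)"
    by (intro sum_nonneg) auto
  ultimately show ?thesis
    using dirichlet_form_eigenfunction[OF eigen] by (simp add: zero_le_mult_iff)
qed

lemma trace_adj: "trace adj = 0"
  by (simp add: adj_def trace_kernel_mat distinct_verts set_verts E_irrefl)

lemma trace_adj_square: "trace (adj ^\<^sub>m 2) = of_nat (n * d)"
proof -
  have "adj ^\<^sub>m 2 = kernel_mat verts verts (\<lambda>u v. \<Sum>w\<in>V. of_bool (E u w) * of_bool (E w v))"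
    using left_mult_one_mat[OF adj_carrier]
    by (simp add: numeral_2_eq_2 adj_def kernel_mat_mult distinct_verts set_verts
        del: sum_of_bool_mult_eq sum_mult_of_bool_eq)
  then have "trace (adj ^\<^sub>m 2) = (\<Sum>v\<in>V. \<Sum>w\<in>nbrs v. of_bool (E v w))"
    by (simp only: trace_kernel_mat distinct_verts set_verts sum_adjacency E_commute)
  also have "\<dots> = (\<Sum>v\<in>V. of_nat (card (nbrs v)))"
    by (intro sum.cong refl) (simp add: nbrs_def finite_nbrs[unfolded nbrs_def])
  finally show ?thesis by (simp add: card_nbrs)
qed

definition closed_3_walks :: "('a \<times> 'a \<times> 'a) set" where
  "closed_3_walks = {(u, v, w). E u v \<and> E v w \<and> E w u}"

lemma finite_closed_3_walks: "finite closed_3_walks"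
  by (rule finite_subset[of _ "V \<times> V \<times> V"]) (auto simp: closed_3_walks_def finite_V dest: E_imp_V)

lemma trace_adj_cube: "trace (adj ^\<^sub>m 3) = of_nat (card closed_3_walks)"
proof -
  have "adj ^\<^sub>m 3 = kernel_mat verts verts
      (\<lambda>u v. \<Sum>w\<in>V. (\<Sum>x\<in>V. of_bool (E u x) * of_bool (E x w)) * of_bool (E w v))"
    using left_mult_one_mat[OF adj_carrier]
    by (simp add: numeral_3_eq_3 adj_def kernel_mat_mult distinct_verts set_verts
        del: sum_of_bool_mult_eq sum_mult_of_bool_eq)
  then have "trace (adj ^\<^sub>m 3) = (\<Sum>u\<in>V. \<Sum>w\<in>V. \<Sum>x\<in>V. of_bool (E u x \<and> E x w \<and> E w u))"
    by (simp only: trace_kernel_mat distinct_verts set_verts sum_distrib_right of_bool_conj mult.assoc)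
  also have "\<dots> = (\<Sum>u\<in>V. \<Sum>x\<in>V. \<Sum>w\<in>V. of_bool (E u x \<and> E x w \<and> E w u))"
    by (rule sum.cong[OF refl], rule sum.swap)
  also have "\<dots> = (\<Sum>a\<in>V \<times> V \<times> V. of_bool (a \<in> closed_3_walks))"
    by (simp add: sum.cartesian_product closed_3_walks_def case_prod_unfold del: sum_of_bool_eq)
  also have "\<dots> = of_nat (card closed_3_walks)"
  proof -
    have "V \<times> V \<times> V \<inter> {a. a \<in> closed_3_walks} = closed_3_walks"
      using E_imp_V by (auto simp: closed_3_walks_def)
    then show ?thesis using finite_V by simp
  qed
  finally show ?thesis .
qed

lemma sum_pow_eigvals_adj:
  assumes "eigvals adj = add_mset (of_nat d) (image_mset of_real L)"
  shows "complex_of_real (real d ^ k + (\<Sum>l\<in>#L. l ^ k)) = trace (adj ^\<^sub>m k)"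
proof -
  have "complex_of_real (\<Sum>l\<in>#L. l ^ k) = (\<Sum>l\<in>#L. of_real l ^ k)" by (induction L) auto
  then show ?thesis
    using trace_pow_eq_sum_eigvals[OF adj_carrier, of k] by (simp add: assms multiset.map_comp comp_def)
qed

lemma spectral_moments:
  assumes L: "eigvals adj = add_mset (of_nat d) (image_mset of_real L)"
  shows "(\<Sum>l\<in>#L. l) = - real d" "(\<Sum>l\<in>#L. l ^ 2) = real n * real d - real d ^ 2"
    "(\<Sum>l\<in>#L. l ^ 3) = real (card closed_3_walks) - real d ^ 3"
proof -
  have moment: "real d ^ k + (\<Sum>l\<in>#L. l ^ k) = r" if "trace (adj ^\<^sub>m k) = of_real r" for k r
    using sum_pow_eigvals_adj[OF L, of k] that by (simp only: of_real_eq_iff)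
  from moment[of 1 0] show "(\<Sum>l\<in>#L. l) = - real d"
    using left_mult_one_mat[OF adj_carrier] trace_adj by simp
  from moment[of 2 "real (n * d)"] show "(\<Sum>l\<in>#L. l ^ 2) = real n * real d - real d ^ 2"
    using trace_adj_square by simp
  from moment[of 3 "real (card closed_3_walks)"]
  show "(\<Sum>l\<in>#L. l ^ 3) = real (card closed_3_walks) - real d ^ 3"
    using trace_adj_cube by simp
qed

section \<open>Recognising complete and complete bipartite graphs\<close>

lemma graph_iso_complete:
  assumes "n = d + 1"
  shows "graph_iso V E (K_verts n) K_adj"
proof -
  have nbrs_eq: "nbrs u = V - {u}" if "u \<in> V" for u
  proof (rule card_subset_eq)
    show "nbrs u \<subseteq> V - {u}" using E_imp_V E_irrefl by (auto simp: nbrs_def)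
  qed (use that finite_V assms in \<open>simp_all add: card_nbrs\<close>)
  obtain f where f: "bij_betw f V {0..<n}"
    using ex_bij_betw_finite_nat[OF finite_V] by blast
  have "E u v \<longleftrightarrow> K_adj (f u) (f v)" if "u \<in> V" "v \<in> V" for u v
  proof -
    have "E u v \<longleftrightarrow> u \<noteq> v" using nbrs_eq[OF that(1)] that by (auto simp: nbrs_def)
    then show ?thesis using bij_betw_imp_inj_on[OF f] that by (simp add: K_adj_def inj_on_eq_iff)
  qed
  then show ?thesis using f unfolding graph_iso_def K_verts_def by blast
qed

lemma triangle_free_imp_nbrs_disjoint:
  assumes "closed_3_walks = {}" "E x y"
  shows "nbrs x \<inter> nbrs y = {}"
proof -
  have "(x, y, z) \<in> closed_3_walks" if "z \<in> nbrs x" "z \<in> nbrs y" for z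
    using that assms(2) E_sym[of x z] by (simp add: closed_3_walks_def nbrs_def)
  then show ?thesis using assms(1) by blast
qed

lemma triangle_free_imp_complete_bipartite:
  assumes "d > 0" "n = 2 * d" and triangle_free: "closed_3_walks = {}"
  obtains A B where "card A = d" "card B = d" "A \<inter> B = {}" "A \<union> B = V"
    "\<And>x y. x \<in> V \<Longrightarrow> y \<in> V \<Longrightarrow> E x y \<longleftrightarrow> (x \<in> A \<longleftrightarrow> y \<in> B)"
proof -
  note disjoint = triangle_free_imp_nbrs_disjoint[OF triangle_free]
  have nbrs_V: "nbrs x \<subseteq> V" for x using E_imp_V by (auto simp: nbrs_def)
  have "n > 0" using assms by simp
  then obtain u where u: "u \<in> V" by (auto simp: card_gt_0_iff)
  then have "nbrs u \<noteq> {}" using assms(1) card_nbrs[OF u] by auto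
  then obtain v where uv: "E u v" by (auto simp: nbrs_def)
  then have v: "v \<in> V" using E_imp_V by blast
  have cover: "nbrs u \<union> nbrs v = V"
    by (rule card_subset_eq[OF finite_V])
      (use disjoint[OF uv] u v nbrs_V assms in \<open>simp_all add: card_Un_disjoint finite_nbrs card_nbrs\<close>)
  have opposite: "nbrs x = nbrs z" if "E y x" "E y z" "nbrs y \<union> nbrs z = V" for x y z
  proof (rule card_subset_eq[OF finite_nbrs])
    show "nbrs x \<subseteq> nbrs z" using disjoint[OF that(1)] nbrs_V that(3) by blast
    show "card (nbrs x) = card (nbrs z)"
      using card_nbrs[OF E_imp_V(2)[OF that(1)]] card_nbrs[OF E_imp_V(2)[OF that(2)]] by simp
  qed
  have nbrs_u: "nbrs x = nbrs v" if "x \<in> nbrs u" for x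
    using opposite[of u x v] that uv cover by (simp add: nbrs_def)
  have nbrs_v: "nbrs x = nbrs u" if "x \<in> nbrs v" for x
    using opposite[of v x u] that E_sym[OF uv] cover by (simp add: nbrs_def Un_commute)
  have "E x y \<longleftrightarrow> (x \<in> nbrs u \<longleftrightarrow> y \<in> nbrs v)" if "x \<in> V" "y \<in> V" for x y
  proof -
    have "E x y \<longleftrightarrow> y \<in> nbrs x" by (simp add: nbrs_def)
    moreover have "y \<in> nbrs u \<longleftrightarrow> y \<notin> nbrs v" "x \<in> nbrs u \<or> x \<in> nbrs v"
      using that cover disjoint[OF uv] by auto
    ultimately show ?thesis using nbrs_u[of x] nbrs_v[of x] by (cases "x \<in> nbrs u") auto
  qed
  then show ?thesis
    using that[of "nbrs u" "nbrs v"] card_nbrs[OF u] card_nbrs[OF v] disjoint[OF uv] cover by simp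
qed

lemma triangle_free_imp_graph_iso_K33:
  assumes "n = 6" "d = 3" "closed_3_walks = {}"
  shows "graph_iso V E K33_verts K33_adj"
proof -
  obtain A B where card: "card A = 3" "card B = 3" and parts: "A \<inter> B = {}" "A \<union> B = V"
    and E_iff: "\<And>x y. x \<in> V \<Longrightarrow> y \<in> V \<Longrightarrow> E x y \<longleftrightarrow> (x \<in> A \<longleftrightarrow> y \<in> B)"
    using triangle_free_imp_complete_bipartite assms by auto
  have "finite A" "finite B" using parts(2) finite_V by (metis finite_Un)+
  then obtain g h where g: "bij_betw g A {0..<3::nat}" and h: "bij_betw h B {3..<6::nat}"
    using finite_same_card_bij[of A "{0..<3::nat}"] finite_same_card_bij[of B "{3..<6::nat}"] card
    by auto
  define f where "f x = (if x \<in> A then g x else h x)" for x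
  have "bij_betw f (A \<union> B) ({0..<3} \<union> {3..<6})"
    unfolding f_def by (rule bij_betw_disjoint_Un[OF g h parts(1)]) auto
  moreover have "{0..<3} \<union> {3..<6} = K33_verts" by (auto simp: K33_verts_def)
  ultimately have "bij_betw f V K33_verts" by (simp only: parts(2))
  moreover have "E x y \<longleftrightarrow> K33_adj (f x) (f y)" if "x \<in> V" "y \<in> V" for x y
  proof -
    have side: "f z < 3 \<longleftrightarrow> z \<in> A" "z \<in> B \<longleftrightarrow> z \<notin> A" if "z \<in> V" for z
      using that parts bij_betwE[OF g] bij_betwE[OF h] by (auto simp: f_def)
    show ?thesis using that by (simp add: E_iff K33_adj_def side flip: not_less)
  qed
  ultimately show ?thesis unfolding graph_iso_def by blast
qed

section \<open>The two walks on arcs\<close>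

abbreviation arcl :: "('a \<times> 'a) list" where "arcl \<equiv> arc_list V E"

definition line_mat :: "complex mat" where
  "line_mat = kernel_mat arcl arcl (\<lambda>a b. of_bool (snd a = fst b))"

definition nb_mat :: "complex mat" where
  "nb_mat = kernel_mat arcl arcl (\<lambda>a b. of_bool (snd a = fst b \<and> snd b \<noteq> fst a))"

definition rev_mat :: "complex mat" where
  "rev_mat = kernel_mat arcl arcl (\<lambda>a b. of_bool (prod.swap a = b))"

definition tail_mat :: "complex mat" where
  "tail_mat = kernel_mat verts arcl (\<lambda>v a. of_bool (v = fst a))"

definition incidence_pencil :: "complex \<Rightarrow> complex mat" where
  "incidence_pencil z = kernel_mat arcl verts (\<lambda>a v. z * of_bool (snd a = v) - of_bool (fst a = v))"

lemma arcs_eq_Sigma: "arcs V E = (SIGMA v:V. nbrs v)"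
  using E_imp_V by (auto simp: arcs_def nbrs_def)

lemma finite_arcs: "finite (arcs V E)"
  by (simp add: arcs_eq_Sigma finite_V finite_nbrs)

lemma distinct_arcl: "distinct arcl" and set_arcl: "set arcl = arcs V E"
  unfolding arc_list_def by (rule finite_enumeration[OF finite_arcs])+

lemma length_arcl [simp]: "length arcl = n * d"
  using distinct_card[OF distinct_arcl]
  by (simp add: set_arcl arcs_eq_Sigma card_nbrs finite_V finite_nbrs)

lemma line_mat_carrier [simp]: "line_mat \<in> carrier_mat (n * d) (n * d)"
  and nb_mat_carrier [simp]: "nb_mat \<in> carrier_mat (n * d) (n * d)"
  and rev_mat_carrier [simp]: "rev_mat \<in> carrier_mat (n * d) (n * d)"
  and tail_mat_carrier [simp]: "tail_mat \<in> carrier_mat n (n * d)"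
  and incidence_pencil_carrier [simp]: "incidence_pencil z \<in> carrier_mat (n * d) n"
  using kernel_mat_carrier[of arcl arcl] kernel_mat_carrier[of verts arcl]
    kernel_mat_carrier[of arcl verts]
  by (simp_all add: line_mat_def nb_mat_def rev_mat_def tail_mat_def incidence_pencil_def)

lemma one_arc_mat: "(1\<^sub>m (n * d) :: complex mat) = kernel_mat arcl arcl (\<lambda>a b. of_bool (a = b))"
  using one_mat_eq_kernel_mat[OF distinct_arcl] by simp

lemma arc_ends_in_V: "a \<in> arcs V E \<Longrightarrow> fst a \<in> V" "a \<in> arcs V E \<Longrightarrow> snd a \<in> V"
  by (auto simp: arcs_def)

lemma swap_in_arcs: "a \<in> arcs V E \<Longrightarrow> prod.swap a \<in> arcs V E"
  by (auto simp: arcs_def E_commute)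

lemma sum_arcs_from:
  fixes g :: "'a \<times> 'a \<Rightarrow> 'b :: semiring_1"
  assumes "u \<in> V"
  shows "(\<Sum>a\<in>arcs V E. of_bool (u = fst a) * g a) = (\<Sum>w\<in>nbrs u. g (u, w))"
proof -
  have "arcs V E \<inter> {a. u = fst a} = Pair u ` nbrs u" using assms by (auto simp: arcs_eq_Sigma)
  then show ?thesis using finite_arcs by (simp add: sum.reindex inj_on_def)
qed

lemma edge_walk_matrix_eq: "edge_walk_matrix V E = (1 / of_nat d) \<cdot>\<^sub>m line_mat"
proof -
  have "edge_walk_matrix V E
      = kernel_mat arcl arcl (\<lambda>a b. if snd a = fst b then 1 / of_nat (degree V E (snd a)) else 0)"
    by (simp add: edge_walk_matrix_def kernel_mat_def Let_def)
  also have "\<dots> = (1 / of_nat d) \<cdot>\<^sub>m line_mat"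
    unfolding line_mat_def kernel_mat_smult
    by (rule kernel_mat_cong) (use regular in \<open>auto simp: regular_def set_arcl arcs_def\<close>)
  finally show ?thesis .
qed

lemma nb_walk_matrix_eq: "nb_walk_matrix V E = (1 / (of_nat d - 1)) \<cdot>\<^sub>m nb_mat"
proof -
  have "nb_walk_matrix V E = kernel_mat arcl arcl
      (\<lambda>a b. if snd a = fst b \<and> snd b \<noteq> fst a then 1 / (of_nat (degree V E (snd a)) - 1) else 0)"
    by (simp add: nb_walk_matrix_def kernel_mat_def Let_def)
  also have "\<dots> = (1 / (of_nat d - 1)) \<cdot>\<^sub>m nb_mat"
    unfolding nb_mat_def kernel_mat_smult
    by (rule kernel_mat_cong) (use regular in \<open>auto simp: regular_def set_arcl arcs_def\<close>)
  finally show ?thesis .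
qed

lemma eigvals_line_mat:
  "replicate_mset n 0 + eigvals line_mat = replicate_mset (n * d) 0 + eigvals adj"
proof -
  define head_mat :: "complex mat" where "head_mat = kernel_mat arcl verts (\<lambda>a v. of_bool (snd a = v))"
  have head: "head_mat \<in> carrier_mat (n * d) n"
    using kernel_mat_carrier[of arcl verts] by (simp add: head_mat_def)
  have "head_mat * tail_mat = line_mat"
    unfolding head_mat_def tail_mat_def line_mat_def kernel_mat_mult[OF distinct_verts] set_verts
    by (rule kernel_mat_cong) (use arc_ends_in_V in \<open>simp only: set_arcl sum_of_bool_delta finite_V\<close>)
  moreover have "tail_mat * head_mat = adj"
    unfolding head_mat_def tail_mat_def adj_def kernel_mat_mult[OF distinct_arcl] set_arcl
    by (rule kernel_mat_cong)
      (simp add: set_verts sum_arcs_from sum_nbrs_indicator del: sum_of_bool_mult_eq sum_of_bool_eq)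
  ultimately show ?thesis using eigvals_mult_swap[OF head tail_mat_carrier] by simp
qed

lemma rev_mat_involution: "rev_mat * rev_mat = 1\<^sub>m (n * d)"
proof -
  have "rev_mat * rev_mat = kernel_mat arcl arcl (\<lambda>a b. of_bool (a = b))"
    unfolding rev_mat_def kernel_mat_mult[OF distinct_arcl] set_arcl
    by (rule kernel_mat_cong)
      (simp add: set_arcl sum_of_bool_delta finite_arcs swap_in_arcs del: sum_of_bool_mult_eq)
  then show ?thesis by (simp only: one_arc_mat)
qed

lemma even_arc_count: "even (n * d)"
  and eigvals_rev_mat:
    "eigvals rev_mat = replicate_mset (n * d div 2) 1 + replicate_mset (n * d div 2) (- 1)"
proof -
  have "trace rev_mat = 0"
    unfolding rev_mat_def trace_kernel_mat[OF distinct_arcl] set_arcl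
    by (rule sum.neutral) (auto simp: arcs_def E_irrefl)
  from eigvals_traceless_involution[OF rev_mat_carrier rev_mat_involution this]
  show "even (n * d)"
    "eigvals rev_mat = replicate_mset (n * d div 2) 1 + replicate_mset (n * d div 2) (- 1)" .
qed

lemma real_half_arc_count: "real (n * d div 2) = real n * real d / 2"
  using even_arc_count by (simp add: real_of_nat_div)

lemma rev_pencil_mult_nb_pencil:
  "(z \<cdot>\<^sub>m 1\<^sub>m (n * d) - rev_mat) * (z \<cdot>\<^sub>m 1\<^sub>m (n * d) - nb_mat)
    = (z\<^sup>2 - 1) \<cdot>\<^sub>m 1\<^sub>m (n * d) - incidence_pencil z * tail_mat"
proof -
  have rev_row: "(\<Sum>b\<in>arcs V E. (z * of_bool (a = b) - of_bool (prod.swap a = b)) * g b)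
      = z * g a - g (prod.swap a)"
    if "a \<in> arcs V E" for a and g :: "'a \<times> 'a \<Rightarrow> complex"
    using that
    by (simp add: left_diff_distrib sum_subtractf sum_of_bool_delta finite_arcs swap_in_arcs mult.assoc
        flip: sum_distrib_left del: sum_of_bool_mult_eq)
  have incidence_row: "(\<Sum>v\<in>V. (z * of_bool (snd a = v) - of_bool (fst a = v)) * g v)
      = z * g (snd a) - g (fst a)"
    if "a \<in> arcs V E" for a and g :: "'a \<Rightarrow> complex"
    using that
    by (simp add: left_diff_distrib sum_subtractf sum_of_bool_delta finite_V arc_ends_in_V mult.assoc
        flip: sum_distrib_left del: sum_of_bool_mult_eq)
  show ?thesis
    unfolding one_arc_mat rev_mat_def nb_mat_def tail_mat_def incidence_pencil_def
      kernel_mat_smult kernel_mat_minus kernel_mat_mult[OF distinct_arcl] kernel_mat_mult[OF distinct_verts]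
      set_arcl set_verts
  proof (rule kernel_mat_cong)
    fix a b assume "a \<in> set arcl" "b \<in> set arcl"
    then have ab: "a \<in> arcs V E" "b \<in> arcs V E" by (simp_all add: set_arcl)
    show "(\<Sum>y\<in>arcs V E. (z * of_bool (a = y) - of_bool (prod.swap a = y))
        * (z * of_bool (y = b) - of_bool (snd y = fst b \<and> snd b \<noteq> fst y)))
      = (z\<^sup>2 - 1) * of_bool (a = b)
        - (\<Sum>y\<in>V. (z * of_bool (snd a = y) - of_bool (fst a = y)) * of_bool (y = fst b))"
      unfolding rev_row[OF ab(1)] incidence_row[OF ab(1)]
      by (cases a; cases b) (auto simp: power2_eq_square algebra_simps)
  qed
qed

lemma tail_mat_mult_incidence_pencil: "tail_mat * incidence_pencil z = z \<cdot>\<^sub>m adj - of_nat d \<cdot>\<^sub>m 1\<^sub>m n"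
proof -
  have "tail_mat * incidence_pencil z
      = kernel_mat verts verts (\<lambda>u v. z * of_bool (E u v) - of_nat d * of_bool (u = v))"
    unfolding incidence_pencil_def tail_mat_def kernel_mat_mult[OF distinct_arcl] set_arcl
  proof (rule kernel_mat_cong)
    fix u v assume "u \<in> set verts" "v \<in> set verts"
    then have u: "u \<in> V" by (simp add: set_verts)
    show "(\<Sum>a\<in>arcs V E. of_bool (u = fst a) * (z * of_bool (snd a = v) - of_bool (fst a = v)))
        = z * of_bool (E u v) - of_nat d * of_bool (u = v)"
      unfolding sum_arcs_from[OF u]
      by (simp add: sum_subtractf sum_nbrs_indicator card_nbrs[OF u]
          flip: sum_distrib_left del: sum_of_bool_eq)
  qed
  also have "\<dots> = z \<cdot>\<^sub>m adj - of_nat d \<cdot>\<^sub>m 1\<^sub>m n"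
    unfolding adj_def length_verts[symmetric] one_mat_eq_kernel_mat[OF distinct_verts]
      kernel_mat_smult kernel_mat_minus ..
  finally show ?thesis .
qed

text \<open>The product of the two pencils differs from (z^2 - 1) I by a matrix that factors through the
  vertices, where Sylvester's identity turns it into a pencil of the adjacency matrix.\<close>

lemma det_rev_pencil_mult_det_nb_pencil:
  "(z\<^sup>2 - 1) ^ n * (det (z \<cdot>\<^sub>m 1\<^sub>m (n * d) - rev_mat) * det (z \<cdot>\<^sub>m 1\<^sub>m (n * d) - nb_mat))
    = (z\<^sup>2 - 1) ^ (n * d) * (\<Prod>e\<in>#eigvals adj. z\<^sup>2 - 1 + of_nat d - z * e)"
proof -
  let ?X = "z \<cdot>\<^sub>m 1\<^sub>m (n * d) - rev_mat" and ?Y = "z \<cdot>\<^sub>m 1\<^sub>m (n * d) - nb_mat"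
  have X: "?X \<in> carrier_mat (n * d) (n * d)" and Y: "?Y \<in> carrier_mat (n * d) (n * d)"
    by (rule minus_carrier_mat, simp)+
  have "(z\<^sup>2 - 1) ^ n * (det ?X * det ?Y)
      = (z\<^sup>2 - 1) ^ n * det ((z\<^sup>2 - 1) \<cdot>\<^sub>m 1\<^sub>m (n * d) - incidence_pencil z * tail_mat)"
    using det_mult[OF X Y] unfolding rev_pencil_mult_nb_pencil by simp
  also have "\<dots> = (z\<^sup>2 - 1) ^ (n * d) * det ((z\<^sup>2 - 1) \<cdot>\<^sub>m 1\<^sub>m n - tail_mat * incidence_pencil z)"
    by (rule sylvester_determinant_identity) simp_all
  also have "(z\<^sup>2 - 1) \<cdot>\<^sub>m 1\<^sub>m n - tail_mat * incidence_pencil z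
      = (z\<^sup>2 - 1 + of_nat d) \<cdot>\<^sub>m 1\<^sub>m n - z \<cdot>\<^sub>m adj"
    unfolding tail_mat_mult_incidence_pencil using carrier_matD[OF adj_carrier]
    by (intro eq_matI) (auto simp: algebra_simps)
  also have "det \<dots> = (\<Prod>e\<in>#eigvals adj. z\<^sup>2 - 1 + of_nat d - z * e)"
    by (rule det_homogeneous_pencil_eq_prod_eigvals[OF adj_carrier])
  finally show ?thesis .
qed

lemma ihara_bass:
  "replicate_mset n 1 + replicate_mset n (- 1) + eigvals nb_mat
    = replicate_mset (n * d div 2) 1 + replicate_mset (n * d div 2) (- 1)
      + (\<Sum>e\<in>#eigvals adj. proots [:of_nat d - 1, - e, 1:])"
proof -
  let ?Q = "\<lambda>e. [:of_nat d - 1, - e, 1 :: complex:]"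
  have "replicate_mset n 1 + replicate_mset n (- 1) + eigvals rev_mat + eigvals nb_mat
      = replicate_mset (n * d) 1 + replicate_mset (n * d) (- 1) + (\<Sum>e\<in>#eigvals adj. proots (?Q e))"
  proof (rule mset_eq_if_prod_diff_eq)
    fix z :: complex
    have unit: "(z - 1) ^ k * (z + 1) ^ k = (z\<^sup>2 - 1) ^ k" for k
      by (simp add: power2_eq_square algebra_simps flip: power_mult_distrib)
    have quadratic: "(\<Prod>r\<in>#proots (?Q e). z - r) = z\<^sup>2 - 1 + of_nat d - z * e" for e
      using poly_eq_prod_proots[of "?Q e" z] by (simp add: power2_eq_square algebra_simps)
    have quadratics: "(\<Prod>r\<in>#(\<Sum>e\<in>#M. proots (?Q e)). z - r) = (\<Prod>e\<in>#M. z\<^sup>2 - 1 + of_nat d - z * e)" for M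
      by (induction M) (simp_all add: quadratic)
    show "(\<Prod>r\<in>#replicate_mset n 1 + replicate_mset n (- 1) + eigvals rev_mat + eigvals nb_mat. z - r)
        = (\<Prod>r\<in>#replicate_mset (n * d) 1 + replicate_mset (n * d) (- 1)
            + (\<Sum>e\<in>#eigvals adj. proots (?Q e)). z - r)"
      using det_rev_pencil_mult_det_nb_pencil[of z]
      unfolding image_mset_union prod_mset_Un quadratics
        det_pencil_eq_prod_eigvals[OF nb_mat_carrier] det_pencil_eq_prod_eigvals[OF rev_mat_carrier]
      by (simp add: unit mult.assoc)
  qed
  moreover have "replicate_mset (n * d) x = replicate_mset (n * d div 2) x + replicate_mset (n * d div 2) x"
    for x :: complex
    using even_arc_count by (intro multiset_eqI) (auto elim!: evenE)
  ultimately show ?thesis unfolding eigvals_rev_mat by (simp add: ac_simps)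
qed

end

section \<open>Kemeny's constants of a connected regular graph\<close>

lemma cubic_minorant_inverse:
  fixes x :: real
  assumes "x < 1"
  shows "1 + x + 3 / 4 * x ^ 2 + 1 / 4 * x ^ 3 \<le> 1 / (1 - x)"
proof -
  have "1 - (1 + x + 3 / 4 * x ^ 2 + 1 / 4 * x ^ 3) * (1 - x) = x\<^sup>2 * (1 + x)\<^sup>2 / 4"
    by (simp add: power2_eq_square power3_eq_cube field_simps)
  moreover have "x\<^sup>2 * (1 + x)\<^sup>2 / 4 \<ge> 0" by simp
  ultimately have "(1 + x + 3 / 4 * x ^ 2 + 1 / 4 * x ^ 3) * (1 - x) \<le> 1" by linarith
  then show ?thesis using assms by (simp add: pos_le_divide_eq)
qed

lemma size_degree_inequality:
  fixes n d :: nat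
  assumes "d \<ge> 3" "d < n" "even (n * d)" "(n, d) \<noteq> (4, 3)" "(n, d) \<noteq> (5, 4)" "(n, d) \<noteq> (6, 3)"
  shows "real n / 2 + real d / (2 * (real d - 2)) < real n - 3 + 3 * real n / (4 * real d)"
proof -
  consider (three) "d = 3" | (four) "d = 4" | (five) "d = 5" | (large) "d \<ge> 6"
    using assms(1) by linarith
  then show ?thesis
  proof cases
    case three
    then have "even n" "n \<noteq> 4" "n \<noteq> 6" "n > 3" using assms by auto
    then have "n \<ge> 8" by presburger
    then show ?thesis using three by simp
  next
    case four
    then have "n \<ge> 6" using assms by auto
    then show ?thesis using four by simp
  next
    case five
    then show ?thesis using assms(2) by simp
  next
    case large
    then have "real d / (2 * (real d - 2)) \<le> 3 / 4" by (simp add: field_simps)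
    moreover have "3 / 4 < 3 * real n / (4 * real d)" using large assms(2) by (simp add: field_simps)
    moreover have "real n \<ge> 7" using large assms(2) by linarith
    ultimately show ?thesis by linarith
  qed
qed

context regular_graph
begin

definition kemeny_v :: real where
  "kemeny_v = kemeny ((1 / of_nat d) \<cdot>\<^sub>m adj)"

lemma kemeny_v_eq:
  assumes "d > 0"
  shows "kemeny_v = Re (resolvent_sum (of_nat d) (eigvals adj))"
  unfolding kemeny_v_def using assms by (intro kemeny_smult_inverse[OF adj_carrier]) auto

lemma kemeny_v_eq_sum:
  assumes "d > 0" and eigvals_adj: "eigvals adj = add_mset (of_nat d) (image_mset of_real L)"
  shows "kemeny_v = (\<Sum>l\<in>#L. real d / (real d - l))"
proof -
  have "complex_of_nat d / (of_nat d - of_real l) = of_real (real d / (real d - l))" for l by simp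
  then have "Re (resolvent_sum (of_nat d) (image_mset of_real M)) = (\<Sum>l\<in>#M. real d / (real d - l))" for M
    by (induction M) (simp_all del: of_real_divide)
  then show ?thesis using \<open>d > 0\<close> by (simp add: kemeny_v_eq eigvals_adj)
qed

lemma kemeny_e_eq:
  assumes "d > 0"
  shows "kemeny_e V E = real n * (real d - 1) + kemeny_v"
proof -
  have "kemeny_e V E = Re (resolvent_sum (of_nat d) (eigvals line_mat))"
    unfolding kemeny_e_def edge_walk_matrix_eq
    using assms by (intro kemeny_smult_inverse[OF line_mat_carrier]) auto
  moreover have "of_nat n + resolvent_sum (of_nat d) (eigvals line_mat)
      = of_nat (n * d) + resolvent_sum (of_nat d) (eigvals adj)"
    using arg_cong[OF eigvals_line_mat, of "resolvent_sum (of_nat d)"] assms by simp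
  then have "real n + Re (resolvent_sum (of_nat d) (eigvals line_mat))
      = real n * real d + Re (resolvent_sum (of_nat d) (eigvals adj))"
    by (simp add: complex_eq_iff)
  ultimately show ?thesis by (simp add: kemeny_v_eq[OF assms] algebra_simps)
qed

lemma kemeny_nb_eq_resolvent_sum:
  assumes "d \<ge> 2"
  shows "kemeny_nb V E = Re (resolvent_sum (of_nat d - 1) (eigvals nb_mat))"
  unfolding kemeny_nb_def nb_walk_matrix_eq using assms
  by (intro kemeny_smult_inverse[OF nb_mat_carrier]) auto

lemma resolvent_sum_nb_mat:
  assumes d_eq: "of_nat d = c + 1" and "c \<noteq> 0" "c \<noteq> - 1"
    and eigvals_adj: "eigvals adj = add_mset (of_nat d) M" and "of_nat d \<notin># M"
  shows "resolvent_sum c (eigvals nb_mat)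
    = (of_nat (n * d div 2) - of_nat n) * (c / (c - 1) + c / (c + 1)) + c / (c - 1)
      + of_nat (size M) + (c - 1) / (c + 1) * resolvent_sum (of_nat d) M"
proof -
  have "(\<Sum>e\<in>#M. resolvent_sum c (proots [:c, - e, 1:]))
      = of_nat (size M) + (c - 1) / (c + 1) * resolvent_sum (of_nat d) M"
    unfolding d_eq using assms by (intro resolvent_sum_ihara_factors) auto
  then have "of_nat n * (c / (c - 1)) + of_nat n * (c / (c + 1)) + resolvent_sum c (eigvals nb_mat)
      = of_nat (n * d div 2) * (c / (c - 1)) + of_nat (n * d div 2) * (c / (c + 1))
        + (c / (c - 1) + (of_nat (size M) + (c - 1) / (c + 1) * resolvent_sum (of_nat d) M))"
    using arg_cong[OF ihara_bass, of "resolvent_sum c"]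
    by (simp add: resolvent_sum_sum_mset eigvals_adj d_eq resolvent_sum_ihara_factor_trivial
        multiset.map_comp comp_def del: minus_add_distrib)
  then show ?thesis by (simp add: algebra_simps)
qed

end

locale connected_regular_graph = regular_graph +
  assumes connected: "connected_graph V E"
begin

lemma n_pos: "n > 0"
  using connected finite_V by (auto simp: connected_graph_def card_gt_0_iff)

lemma harmonic_imp_constant:
  fixes f :: "'a \<Rightarrow> complex"
  assumes harmonic: "\<And>v. v \<in> V \<Longrightarrow> (\<Sum>w\<in>nbrs v. f w) = of_nat d * f v"
    and "u \<in> V" "v \<in> V"
  shows "f u = f v"
proof -
  have "(\<Sum>v\<in>V. \<Sum>w\<in>nbrs v. (cmod (f v - f w))\<^sup>2) = 0"
    using dirichlet_form_eigenfunction[OF harmonic] by simp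
  then have "\<forall>v\<in>V. \<forall>w\<in>nbrs v. f v = f w"
    using finite_V finite_nbrs by (simp add: sum_nonneg_eq_0_iff sum_nonneg)
  then have edge: "f v = f w" if "E v w" for v w
    using that E_imp_V(1)[OF that] by (auto simp: nbrs_def)
  have "(u, v) \<in> {(x, y). E x y}\<^sup>*" using connected assms by (auto simp: connected_graph_def)
  then show ?thesis by (induction rule: rtrancl_induct) (auto dest: edge)
qed

lemma degree_not_eigenvalue_deflated:
  "\<not> eigenvalue (kernel_mat verts verts (\<lambda>u v. of_bool (E u v) - 1)) (of_nat d :: complex)"
proof
  assume ev: "eigenvalue (kernel_mat verts verts (\<lambda>u v. of_bool (E u v) - 1)) (of_nat d :: complex)"
  obtain f :: "'a \<Rightarrow> complex" where nonzero: "\<exists>v\<in>V. f v \<noteq> 0"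
    and eigen: "\<And>v. v \<in> V \<Longrightarrow> (\<Sum>w\<in>V. (of_bool (E v w) - 1) * f w) = of_nat d * f v"
    using eigenvalue_kernel_matE[OF ev distinct_verts, unfolded set_verts] by blast
  have shifted: "(\<Sum>w\<in>nbrs v. f w) = of_nat d * f v + sum f V" if "v \<in> V" for v
    using eigen[OF that] unfolding left_diff_distrib sum_subtractf sum_adjacency
    by (simp add: algebra_simps)
  have "(\<Sum>v\<in>V. \<Sum>w\<in>nbrs v. f w) = (\<Sum>v\<in>V. of_nat d * f v)"
    by (subst sum_nbrs_swap) (simp add: card_nbrs)
  then have "of_nat n * sum f V = 0"
    by (simp add: shifted sum.distrib)
  then have sum_zero: "sum f V = 0" using n_pos by simp
  obtain v where v: "v \<in> V" "f v \<noteq> 0" using nonzero by blast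
  have "f u = f v" if "u \<in> V" for u
    by (rule harmonic_imp_constant) (use shifted sum_zero v that in auto)
  then have "sum f V = of_nat n * f v" by simp
  with sum_zero v n_pos show False by simp
qed

text \<open>Subtracting the all-ones matrix moves one copy of the eigenvalue d to d - n.\<close>

lemma count_eigvals_adj_degree: "count (eigvals adj) (of_nat d) = 1"
proof -
  let ?v = "kernel_mat verts [()] (\<lambda>_ _. 1 :: complex)"
    and ?w = "kernel_mat [()] verts (\<lambda>_ _. - 1 :: complex)"
  have v: "?v \<in> carrier_mat n 1" and w: "?w \<in> carrier_mat 1 n"
    using kernel_mat_carrier[of verts "[()]"] kernel_mat_carrier[of "[()]" verts] by simp_all
  have eigenvector: "adj * ?v = of_nat d \<cdot>\<^sub>m ?v"
    unfolding adj_def kernel_mat_mult[OF distinct_verts] kernel_mat_smult set_verts sum_adjacency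
    by (rule kernel_mat_cong) (simp add: set_verts card_nbrs)
  have deflated: "adj + ?v * ?w = kernel_mat verts verts (\<lambda>u v. of_bool (E u v) - 1)"
    by (simp add: adj_def kernel_mat_mult kernel_mat_add)
  have "(?w * ?v) $$ (0, 0) = - of_nat n"
    by (simp add: kernel_mat_mult distinct_verts set_verts) (simp add: kernel_mat_def)
  then have "add_mset (of_nat d - of_nat n) (eigvals adj)
      = add_mset (of_nat d) (eigvals (adj + ?v * ?w))"
    using eigvals_rank_one_update[OF adj_carrier v w eigenvector] by simp
  moreover have "of_nat d \<notin># eigvals (adj + ?v * ?w)"
    using degree_not_eigenvalue_deflated in_eigvals_iff[OF kernel_mat_carrier]
    unfolding deflated by blast
  ultimately have "count (add_mset (of_nat d - of_nat n) (eigvals adj)) (of_nat d) = 1"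
    by (simp add: not_in_iff del: count_add_mset) simp
  then show ?thesis using n_pos by (simp split: if_splits)
qed

lemma eigvals_adj_decomposition:
  obtains L :: "real multiset" where
    "eigvals adj = add_mset (of_nat d) (image_mset of_real L)" "size L = n - 1"
    "\<And>l. l \<in># L \<Longrightarrow> l < real d"
proof -
  define M where "M = eigvals adj - {#of_nat d#}"
  have eigvals_adj: "eigvals adj = add_mset (of_nat d) M"
    using count_eigvals_adj_degree by (simp add: M_def flip: count_greater_zero_iff)
  have M: "e \<in> \<real> \<and> Re e < real d" if "e \<in># M" for e
  proof -
    have "e \<in># eigvals adj" using that by (simp add: eigvals_adj)
    then have "eigenvalue adj e" using in_eigvals_iff[OF adj_carrier] by simp
    note ev = eigenvalue_adj_real[OF this] eigenvalue_adj_le[OF this]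
    have "e \<noteq> of_nat d" using count_eigvals_adj_degree that
      by (auto simp: eigvals_adj count_eq_zero_iff)
    then have "Re e \<noteq> real d" using ev(1) by (metis of_real_Re of_real_of_nat_eq)
    with ev show ?thesis by simp
  qed
  then have "image_mset of_real (image_mset Re M) = M"
    by (simp add: multiset.map_comp comp_def cong: image_mset_cong)
  moreover have "size M = n - 1" using size_eigvals[OF adj_carrier] by (simp add: eigvals_adj)
  ultimately show ?thesis using that[of "image_mset Re M"] M by (auto simp: eigvals_adj)
qed

lemma kemeny_nb_eq:
  assumes d: "d \<ge> 3"
  shows "kemeny_nb V E = real n * (real d - 1)\<^sup>2 / real d + (real d - 1) / (real d - 2) + (real n - 1)
    + (1 - 2 / real d) * kemeny_v"
proof -
  define q where "q = real d - 1"
  define c where "c = complex_of_real q"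
  have q: "q \<ge> 2" using d by (simp add: q_def)
  have d_real: "q + 1 = real d" by (simp add: q_def)
  have d_eq: "of_nat d = c + 1" by (simp add: c_def q_def)
  obtain L where eigvals_adj: "eigvals adj = add_mset (of_nat d) (image_mset of_real L)"
    and size_L: "size L = n - 1" and less: "\<And>l. l \<in># L \<Longrightarrow> l < real d"
    using eigvals_adj_decomposition by metis
  define S where "S = resolvent_sum (of_nat d) (image_mset of_real L)"
  have kemeny_v: "kemeny_v = Re S" using d by (simp add: kemeny_v_eq eigvals_adj S_def)
  have "resolvent_sum c (eigvals nb_mat)
      = (of_nat (n * d div 2) - of_nat n) * (c / (c - 1) + c / (c + 1)) + c / (c - 1)
        + of_nat (size (image_mset complex_of_real L)) + (c - 1) / (c + 1) * S"
    unfolding S_def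
  proof (rule resolvent_sum_nb_mat[OF d_eq _ _ eigvals_adj])
    show "c \<noteq> 0" "c \<noteq> - 1" using q by (auto simp: c_def complex_eq_iff)
    show "of_nat d \<notin># image_mset complex_of_real L"
      using less by (force simp: complex_eq_iff)
  qed
  also have "\<dots> = of_real ((real (n * d div 2) - real n) * (q / (q - 1) + q / (q + 1)) + q / (q - 1)
      + real (n - 1)) + of_real ((q - 1) / (q + 1)) * S"
    by (simp add: c_def size_L)
  finally have "Re (resolvent_sum c (eigvals nb_mat))
      = (real (n * d div 2) - real n) * (q / (q - 1) + q / (q + 1)) + q / (q - 1) + real (n - 1)
        + (q - 1) / (q + 1) * kemeny_v"
    by (simp add: kemeny_v)
  moreover have "kemeny_nb V E = Re (resolvent_sum c (eigvals nb_mat))"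
    using kemeny_nb_eq_resolvent_sum d by (simp add: d_eq)
  moreover have "(real (n * d div 2) - real n) * (q / (q - 1) + q / (q + 1)) = real n * q\<^sup>2 / (q + 1)"
    unfolding real_half_arc_count using q
    by (simp add: divide_simps flip: d_real) (simp add: power2_eq_square algebra_simps)
  moreover have "(q - 1) / (q + 1) = 1 - 2 / real d" using q by (simp add: q_def field_simps)
  ultimately have "kemeny_nb V E
      = real n * q\<^sup>2 / (q + 1) + q / (q - 1) + real (n - 1) + (1 - 2 / real d) * kemeny_v"
    by (simp only:)
  then show ?thesis using n_pos by (simp add: q_def of_nat_diff)
qed

lemma kemeny_v_ge_closed_walks:
  assumes d: "d > 0"
  shows "real n - 3 + 3 * real n / (4 * real d) + real (card closed_3_walks) / (4 * real d ^ 3)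
    \<le> kemeny_v"
proof -
  obtain L where eigvals_adj: "eigvals adj = add_mset (of_nat d) (image_mset of_real L)"
    and size_L: "size L = n - 1" and less: "\<And>l. l \<in># L \<Longrightarrow> l < real d"
    using eigvals_adj_decomposition by metis
  have minorant: "(\<Sum>l\<in>#L. 1 + l / real d + 3 / 4 * (l / real d) ^ 2 + 1 / 4 * (l / real d) ^ 3)
      = real (size L) + (\<Sum>l\<in>#L. l) / real d + 3 / 4 * (\<Sum>l\<in>#L. l ^ 2) / real d ^ 2
        + (\<Sum>l\<in>#L. l ^ 3) / (4 * real d ^ 3)"
    by (induction L) (simp_all add: power_divide add_divide_distrib algebra_simps)
  have "real n - 3 + 3 * real n / (4 * real d) + real (card closed_3_walks) / (4 * real d ^ 3)
      = (\<Sum>l\<in>#L. 1 + l / real d + 3 / 4 * (l / real d) ^ 2 + 1 / 4 * (l / real d) ^ 3)"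
    unfolding minorant spectral_moments[OF eigvals_adj] size_L using n_pos d
    by (simp add: of_nat_diff field_simps power2_eq_square power3_eq_cube)
  also have "\<dots> \<le> (\<Sum>l\<in>#L. 1 / (1 - l / real d))"
    using less d by (intro sum_mset_mono cubic_minorant_inverse) auto
  also have "\<dots> = (\<Sum>l\<in>#L. real d / (real d - l))"
    using d by (simp add: field_simps)
  also have "\<dots> = kemeny_v"
    using kemeny_v_eq_sum[OF d eigvals_adj] by simp
  finally show ?thesis .
qed

lemma kemeny_v_ge:
  assumes "d > 0"
  shows "real n - 3 + 3 * real n / (4 * real d) \<le> kemeny_v"
proof -
  have "0 \<le> real (card closed_3_walks) / (4 * real d ^ 3)" by simp
  with kemeny_v_ge_closed_walks[OF assms] show ?thesis by linarith
qed

lemma degree_less_n: "d < n"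
proof -
  obtain v where v: "v \<in> V" using n_pos by (auto simp: card_gt_0_iff)
  then have "nbrs v \<subset> V" using E_imp_V E_irrefl by (auto simp: nbrs_def)
  then show ?thesis using psubset_card_mono[OF finite_V] v by (simp add: card_nbrs[symmetric])
qed

lemma kemeny_v_gt:
  assumes d: "d \<ge> 3"
    and K4: "\<not> graph_iso V E (K_verts 4) K_adj"
    and K5: "\<not> graph_iso V E (K_verts 5) K_adj"
    and K33: "\<not> graph_iso V E K33_verts K33_adj"
  shows "real n / 2 + real d / (2 * (real d - 2)) < kemeny_v"
proof (cases "n = 6 \<and> d = 3")
  case True
  then have "closed_3_walks \<noteq> {}" using triangle_free_imp_graph_iso_K33 K33 by blast
  then have "card closed_3_walks > 0" using finite_closed_3_walks by (simp add: card_gt_0_iff)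
  then show ?thesis using kemeny_v_ge_closed_walks True by simp
next
  case False
  have "(n, d) \<noteq> (4, 3)" "(n, d) \<noteq> (5, 4)" using graph_iso_complete K4 K5 by auto
  then have "real n / 2 + real d / (2 * (real d - 2)) < real n - 3 + 3 * real n / (4 * real d)"
    using False d degree_less_n even_arc_count by (intro size_degree_inequality) auto
  also have "\<dots> \<le> kemeny_v" using d by (intro kemeny_v_ge) simp
  finally show ?thesis .
qed

lemma kemeny_e_pos:
  assumes d: "d \<ge> 3"
  shows "kemeny_e V E > 0"
proof -
  have "3 < n" using d degree_less_n by simp
  then have "0 < real n - 3 + 3 * real n / (4 * real d)" by (simp add: add_pos_nonneg)
  also have "\<dots> \<le> kemeny_v" using d by (intro kemeny_v_ge) simp
  finally have "0 < kemeny_v" .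
  then show ?thesis using d by (simp add: kemeny_e_eq add_nonneg_pos)
qed

lemma kemeny_nb_gt:
  assumes d: "d \<ge> 3"
  shows "(1 - 2 / real d) * kemeny_e V E < kemeny_nb V E"
proof -
  define r where "r = real d"
  have r: "r \<ge> 3" using d by (simp add: r_def)
  have kemeny_e: "kemeny_e V E = real n * (r - 1) + kemeny_v" using d by (simp add: kemeny_e_eq r_def)
  have "0 < real n * (r - 1) / r" "0 < (r - 1) / (r - 2)" "0 \<le> real n - 1"
    using r n_pos by simp_all
  then have "0 < real n * (r - 1) / r + (real n - 1) + (r - 1) / (r - 2)" by linarith
  also have "\<dots> = kemeny_nb V E - (1 - 2 / r) * kemeny_e V E"
    unfolding kemeny_e kemeny_nb_eq[OF d, folded r_def] using r
    by (simp add: field_simps power2_eq_square)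
  finally show ?thesis by (simp add: r_def)
qed

lemma kemeny_nb_less_kemeny_e_iff:
  assumes d: "d \<ge> 3"
  shows "kemeny_nb V E < kemeny_e V E \<longleftrightarrow> real n / 2 + real d / (2 * (real d - 2)) < kemeny_v"
proof -
  define r where "r = real d"
  have r: "r \<ge> 3" using d by (simp add: r_def)
  have kemeny_e: "kemeny_e V E = real n * (r - 1) + kemeny_v" using d by (simp add: kemeny_e_eq r_def)
  have gap: "kemeny_e V E - kemeny_nb V E = 2 / r * (kemeny_v - (real n / 2 + r / (2 * (r - 2))))"
    unfolding kemeny_e kemeny_nb_eq[OF d, folded r_def] using r
    by (simp add: field_simps power2_eq_square)
  have "0 < 2 / r" using r by simp
  from mult_less_cancel_left_pos[OF this, of 0]
  have "0 < kemeny_e V E - kemeny_nb V E \<longleftrightarrow> 0 < kemeny_v - (real n / 2 + r / (2 * (r - 2)))"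
    unfolding gap by (simp only: mult_zero_right)
  then show ?thesis by (simp add: r_def)
qed

end

theorem theorem3p4:
  fixes V :: "'a set" and E :: "'a \<Rightarrow> 'a \<Rightarrow> bool" and d :: nat
  assumes "simple_graph V E"
    and "connected_graph V E"
    and "regular V E d"
    and "d \<ge> 3"
    and "\<not> graph_iso V E (K_verts 4) K_adj"
    and "\<not> graph_iso V E (K_verts 5) K_adj"
    and "\<not> graph_iso V E K33_verts K33_adj"
  shows "1 - 2 / real d < kemeny_nb V E / kemeny_e V E
       \<and> kemeny_nb V E / kemeny_e V E < 1"
proof -
  interpret connected_regular_graph V E d
    by unfold_locales (fact assms)+
  have "kemeny_e V E > 0" using assms(4) by (rule kemeny_e_pos)
  moreover have "(1 - 2 / real d) * kemeny_e V E < kemeny_nb V E" using assms(4) by (rule kemeny_nb_gt)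
  moreover have "kemeny_nb V E < kemeny_e V E"
    using kemeny_v_gt[OF assms(4-7)] kemeny_nb_less_kemeny_e_iff[OF assms(4)] by blast
  ultimately show ?thesis by (simp add: pos_less_divide_eq pos_divide_less_eq)
qed

end
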